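(* Let $N$ be a finite ground set, let $\mathcal{L} \subseteq \mathcal{A}_N$ be a set of conditional independence statements with $|\mathcal{L}| \le 2$, and let $\mathcal{G}$ be a minimal gaussoid extension of $\mathcal{L}$. Then for every real $\varepsilon > 0$ there is a symmetric positive-definite $N \times N$ matrix $\Sigma$ with rational entries, at distance less than $\varepsilon$ from the identity matrix, such that $[\![\Sigma]\!] = \mathcal{G}$.
   Context: Elements $i \in N$ are identified with singletons and juxtaposition denotes union of subsets of $N$ (so $ijK = \{i,j\} \cup K$). The set of conditional independence (CI) statements over $N$ is $\mathcal{A}_N = \{(ij|K) : i,j \in N \text{ distinct}, K \subseteq N \setminus ij\}$, where $(ij|K) = (ji|K)$. A CI structure over $N$ is a subset of $\mathcal{A}_N$. For a symmetric $N \times N$ matrix $\Sigma$, $[\![\Sigma]\!] = \{(ij|K) \in \mathcal{A}_N : \det \Sigma_{iK,jK} = 0\}$, where $\Sigma_{iK,jK}$ is the submatrix with rows $iK$ and columns $jK$. A gaussoid over $N$ is a subset of $\mathcal{A}_N$ which satisfies, for all distinct $i,j,k \in N$ and $L \subseteq N \setminus ijk$, the gaussoid axioms (a formula is satisfied when truth of a CI statement is interpreted as membership in the set): (i) $(ij|L) \wedge (ik|jL) \Leftrightarrow (ik|L) \wedge (ij|kL)$; (ii) $(ij|kL) \wedge (ik|jL) \Leftrightarrow (ij|L) \wedge (ik|L)$; (iii) $(ij|L) \wedge (ij|kL) \Rightarrow (ik|L) \vee (jk|L)$. A minimal gaussoid extension of $\mathcal{L} \subseteq \mathcal{A}_N$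 is an inclusion-minimal element among the gaussoids over $N$ containing $\mathcal{L}$ (it need not be unique). Distances are taken with respect to any fixed norm on the space of real $N \times N$ matrices. *)

theory Defs
  imports Complex_Main "Jordan_Normal_Form.Determinant" "HOL-Combinatorics.List_Permutation"
begin

section \<open>Conditional independence statements and gaussoids\<close>

text \<open>The statement \<open>(ij|K)\<close> is the pair \<open>({i,j}, K)\<close>, so that \<open>(ij|K) = (ji|K)\<close> holds
  definitionally and cardinalities of sets of statements are the intended ones.\<close>

type_synonym 'a ci_stmt = "'a set \<times> 'a set"

abbreviation ci :: "'a \<Rightarrow> 'a \<Rightarrow> 'a set \<Rightarrow> 'a ci_stmt" where
  "ci i j K \<equiv> ({i, j}, K)"

definition ci_statements :: "'a set \<Rightarrow> 'a ci_stmt set" where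
  "ci_statements N = {ci i j K | i j K. i \<in> N \<and> j \<in> N \<and> i \<noteq> j \<and> K \<subseteq> N - {i, j}}"

definition gaussoid :: "'a set \<Rightarrow> 'a ci_stmt set \<Rightarrow> bool" where
  "gaussoid N G \<longleftrightarrow> G \<subseteq> ci_statements N \<and>
     (\<forall>i\<in>N. \<forall>j\<in>N. \<forall>k\<in>N. \<forall>L. i \<noteq> j \<and> i \<noteq> k \<and> j \<noteq> k \<and> L \<subseteq> N - {i, j, k} \<longrightarrow>
        (ci i j L \<in> G \<and> ci i k (insert j L) \<in> G \<longleftrightarrow> ci i k L \<in> G \<and> ci i j (insert k L) \<in> G) \<and>
        (ci i j (insert k L) \<in> G \<and> ci i k (insert j L) \<in> G \<longleftrightarrow> ci i j L \<in> G \<and> ci i k L \<in> G) \<and>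
        (ci i j L \<in> G \<and> ci i j (insert k L) \<in> G \<longrightarrow> ci i k L \<in> G \<or> ci j k L \<in> G))"

definition minimal_gaussoid_extension :: "'a set \<Rightarrow> 'a ci_stmt set \<Rightarrow> 'a ci_stmt set \<Rightarrow> bool" where
  "minimal_gaussoid_extension N L G \<longleftrightarrow> gaussoid N G \<and> L \<subseteq> G \<and>
     (\<forall>H. gaussoid N H \<and> L \<subseteq> H \<and> H \<subseteq> G \<longrightarrow> H = G)"


section \<open>Matrices indexed by a finite set\<close>

text \<open>A real \<open>N \<times> N\<close> matrix is a function vanishing outside \<open>N \<times> N\<close>; this makes equality of
  functions coincide with equality of matrices.\<close>

definition matrices :: "'a set \<Rightarrow> ('a \<Rightarrow> 'a \<Rightarrow> real) set" where
  "matrices N = {S. \<forall>a b. a \<notin> N \<or> b \<notin> N \<longrightarrow> S a b = 0}"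

definition identity_matrix :: "'a set \<Rightarrow> 'a \<Rightarrow> 'a \<Rightarrow> real" where
  "identity_matrix N a b = (if a \<in> N \<and> a = b then 1 else 0)"

definition symmetric_matrix :: "'a set \<Rightarrow> ('a \<Rightarrow> 'a \<Rightarrow> real) \<Rightarrow> bool" where
  "symmetric_matrix N S \<longleftrightarrow> (\<forall>a\<in>N. \<forall>b\<in>N. S a b = S b a)"

definition positive_definite :: "'a set \<Rightarrow> ('a \<Rightarrow> 'a \<Rightarrow> real) \<Rightarrow> bool" where
  "positive_definite N S \<longleftrightarrow>
     (\<forall>x :: 'a \<Rightarrow> real. (\<exists>a\<in>N. x a \<noteq> 0) \<longrightarrow> (\<Sum>a\<in>N. \<Sum>b\<in>N. x a * S a b * x b) > 0)"

text \<open>An arbitrary norm on the vector space \<open>matrices N\<close>; no compatibility with matrix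
  multiplication is required.\<close>

definition norm_on_matrices :: "'a set \<Rightarrow> (('a \<Rightarrow> 'a \<Rightarrow> real) \<Rightarrow> real) \<Rightarrow> bool" where
  "norm_on_matrices N nrm \<longleftrightarrow>
     (\<forall>A\<in>matrices N. nrm A \<ge> 0) \<and>
     (\<forall>A\<in>matrices N. nrm A = 0 \<longleftrightarrow> A = (\<lambda>a b. 0)) \<and>
     (\<forall>A\<in>matrices N. \<forall>c. nrm (\<lambda>a b. c * A a b) = \<bar>c\<bar> * nrm A) \<and>
     (\<forall>A\<in>matrices N. \<forall>B\<in>matrices N. nrm (\<lambda>a b. A a b + B a b) \<le> nrm A + nrm B)"

definition submatrix_of :: "('a \<Rightarrow> 'a \<Rightarrow> real) \<Rightarrow> 'a list \<Rightarrow> 'a list \<Rightarrow> real mat" where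
  "submatrix_of S rs cs = mat (length rs) (length cs) (\<lambda>(p, q). S (rs ! p) (cs ! q))"

text \<open>Since rows and columns carry no order, the minor with rows \<open>R\<close> and columns \<open>C\<close> is only
  defined up to sign, which is fixed by choosing enumerations. By the lemma
  \<open>minor_eq_0_iff\<close> below, its vanishing does not depend on this choice.\<close>

definition enumeration :: "'a set \<Rightarrow> 'a list" where
  "enumeration A = (SOME xs. distinct xs \<and> set xs = A)"

definition minor :: "('a \<Rightarrow> 'a \<Rightarrow> real) \<Rightarrow> 'a set \<Rightarrow> 'a set \<Rightarrow> real" where
  "minor S R C = det (submatrix_of S (enumeration R) (enumeration C))"

definition ci_structure :: "'a set \<Rightarrow> ('a \<Rightarrow> 'a \<Rightarrow> real) \<Rightarrow> 'a ci_stmt set" where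
  "ci_structure N S = {ci i j K | i j K. i \<in> N \<and> j \<in> N \<and> i \<noteq> j \<and> K \<subseteq> N - {i, j} \<and>
     minor S (insert i K) (insert j K) = 0}"


section \<open>Well-definedness of vanishing of minors\<close>

lemma enumeration:
  assumes "finite A"
  shows "distinct (enumeration A)" "set (enumeration A) = A"
proof -
  have "\<exists>xs. distinct xs \<and> set xs = A"
    using finite_distinct_list[OF assms] by blast
  from someI_ex[OF this] show "distinct (enumeration A)" "set (enumeration A) = A"
    by (simp_all add: enumeration_def)
qed

lemma det_submatrix_of_transpose:
  assumes "length rs = length cs"
  shows "det (submatrix_of S rs cs) = det (submatrix_of (\<lambda>a b. S b a) cs rs)"
proof -
  have "submatrix_of (\<lambda>a b. S b a) cs rs = transpose_mat (submatrix_of S rs cs)"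
    by (rule eq_matI) (simp_all add: submatrix_of_def)
  moreover have "submatrix_of S rs cs \<in> carrier_mat (length rs) (length rs)"
    using assms by (simp add: submatrix_of_def)
  ultimately show ?thesis
    using det_transpose by metis
qed

lemma det_submatrix_of_rows:
  assumes "mset rs = mset rs'" "length rs = length cs"
  shows "det (submatrix_of S rs cs) = 0 \<longleftrightarrow> det (submatrix_of S rs' cs) = 0"
proof -
  obtain p where p: "p permutes {..<length rs'}" "permute_list p rs' = rs"
    using mset_eq_permutation[OF assms(1)] by blast
  let ?n = "length rs'"
  have len: "length rs = ?n" "length cs = ?n"
    using assms mset_eq_length by metis+
  let ?A = "submatrix_of S rs' cs"
  have A: "?A \<in> carrier_mat ?n ?n"
    using len by (simp add: submatrix_of_def)
  have p': "p permutes {0..<?n}"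
    using p(1) by (simp add: atLeast0LessThan)
  have "submatrix_of S rs cs = mat ?n ?n (\<lambda>(i, j). ?A $$ (p i, j))"
  proof (rule eq_matI)
    fix i j
    assume ij: "i < dim_row (mat ?n ?n (\<lambda>(i, j). ?A $$ (p i, j)))"
      "j < dim_col (mat ?n ?n (\<lambda>(i, j). ?A $$ (p i, j)))"
    have "p i < ?n"
      using ij permutes_in_image[OF p(1), of i] by simp
    moreover have "rs ! i = rs' ! p i"
      using p ij permute_list_nth[OF p(1), of i] by simp
    ultimately show "submatrix_of S rs cs $$ (i, j) = mat ?n ?n (\<lambda>(i, j). ?A $$ (p i, j)) $$ (i, j)"
      using ij len by (simp add: submatrix_of_def)
  qed (use len in \<open>simp_all add: submatrix_of_def\<close>)
  then have "det (submatrix_of S rs cs) = signof p * det ?A"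
    using det_permute_rows[OF A p'] by simp
  then show ?thesis
    by (simp add: sign_def)
qed

lemma minor_eq_0_iff:
  assumes "distinct rs" "set rs = R" "distinct cs" "set cs = C" "card R = card C"
  shows "minor S R C = 0 \<longleftrightarrow> det (submatrix_of S rs cs) = 0"
proof -
  have fin: "finite R" "finite C"
    using assms by auto
  note R = enumeration[OF fin(1)] and C = enumeration[OF fin(2)]
  have mR: "mset (enumeration R) = mset rs" and mC: "mset (enumeration C) = mset cs"
    using R C assms set_eq_iff_mset_eq_distinct by metis+
  have len: "length (enumeration R) = length (enumeration C)" "length rs = length (enumeration C)"
    "length rs = length cs"
    using R C assms distinct_card by metis+
  have "minor S R C = 0 \<longleftrightarrow> det (submatrix_of S rs (enumeration C)) = 0"
    unfolding minor_def by (rule det_submatrix_of_rows[OF mR len(1)])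
  also have "\<dots> \<longleftrightarrow> det (submatrix_of (\<lambda>a b. S b a) (enumeration C) rs) = 0"
    by (simp add: det_submatrix_of_transpose[OF len(2)])
  also have "\<dots> \<longleftrightarrow> det (submatrix_of (\<lambda>a b. S b a) cs rs) = 0"
    by (rule det_submatrix_of_rows[OF mC]) (simp add: len)
  also have "\<dots> \<longleftrightarrow> det (submatrix_of S rs cs) = 0"
    by (simp add: det_submatrix_of_transpose[OF len(3)])
  finally show ?thesis .
qed

end

theory Submission
  imports Defs
begin

text \<open>
  The gaussoid axioms leave few minimal extensions of at most two statements: either \<open>L\<close> itself,
  or the four statements \<open>(ij|L)\<close>, \<open>(ik|L)\<close>, \<open>(ij|kL)\<close>, \<open>(ik|jL)\<close> expressing that \<open>i\<close> is independent
  of \<open>jk\<close> given \<open>L\<close>.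

  Principal pivots add or remove indices from all conditioning sets at once. They keep a matrix
  rational and close to the identity, but make it symmetric only up to the signs recorded in
  \<open>sign_symmetric\<close>. Hence one statement may be assumed to be \<open>(ij|{})\<close>, that is \<open>S i j = 0\<close>, after
  which the second one can be solved rationally for another entry.

  All remaining off-diagonal entries are \<open>\<plusminus>\<delta> 3 ^ (f a * f b)\<close> with \<open>f\<close> injective. To second order
  in \<open>\<delta>\<close>, the statement \<open>(ab|C)\<close> says that \<open>S a b\<close> equals the sum of the \<open>S a c * S c b\<close> over
  \<open>c \<in> C\<close>. This fails if \<open>S a b\<close> has order \<open>\<delta>\<close>; and since nonempty signed sums of distinct powers of 3
  do not vanish, for small \<open>S a b\<close> it essentially determines \<open>C\<close>.
\<close>

section \<open>Kernel vectors of almost-principal submatrices\<close>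

text \<open>Determinants are replaced by kernel vectors extended by zero to all of \<open>N\<close>.
  Then no index set has to be enumerated, a pivot merely exchanges one coordinate of argument and
  value, and near the identity such a vector is determined to first order by its coordinate at
  \<open>j\<close>.

  Solving for an entry is easy; the obstacle is to exclude unwanted statements. The second-order
  comparison controls only conditioning indices \<open>c\<close> for which both factors of
  \<open>S a c * S c b\<close> have the prescribed size, and it is blind where an adjusted entry is
  involved. The remaining ambiguities are settled by the exact formula for singleton conditioning
  sets, by weak transitivity of matrices, or by making the adjusted entry large. The last is needed
  when both statements concern the same pair: the entry of that pair is already 0, so another one
  must be solved for.

  The gaussoid axioms enter twice: they classify the extensions, and for two statements they exclude
  the positions in which further statements would be forced.\<close>

definition singular :: "'a set \<Rightarrow> ('a \<Rightarrow> 'a \<Rightarrow> real) \<Rightarrow> 'a \<Rightarrow> 'a \<Rightarrow> 'a set \<Rightarrow> bool" where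
  "singular N S i j K \<longleftrightarrow> (\<exists>x. (\<exists>a\<in>N. x a \<noteq> 0) \<and> (\<forall>a\<in>N - insert j K. x a = 0) \<and>
     (\<forall>a\<in>insert i K. (\<Sum>b\<in>N. S a b * x b) = 0))"

lemma singularI:
  assumes "\<exists>a\<in>N. x a \<noteq> 0" "\<And>a. a \<in> N \<Longrightarrow> a \<noteq> j \<Longrightarrow> a \<notin> K \<Longrightarrow> x a = 0"
    "\<And>a. a = i \<or> a \<in> K \<Longrightarrow> (\<Sum>b\<in>N. S a b * x b) = 0"
  shows "singular N S i j K"
  unfolding singular_def using assms by (intro exI[of _ x]) auto

lemma singularE:
  assumes "singular N S i j K"
  obtains x where "\<exists>a\<in>N. x a \<noteq> 0" "\<And>a. a \<in> N \<Longrightarrow> a \<noteq> j \<Longrightarrow> a \<notin> K \<Longrightarrow> x a = 0"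
    "(\<Sum>b\<in>N. S i b * x b) = 0" "\<And>a. a \<in> K \<Longrightarrow> (\<Sum>b\<in>N. S a b * x b) = 0"
  using assms unfolding singular_def by blast

lemma singular_cong:
  assumes "\<And>a b. a = i \<or> a \<in> K \<Longrightarrow> b = j \<or> b \<in> K \<Longrightarrow> S a b = S' a b"
  shows "singular N S i j K \<longleftrightarrow> singular N S' i j K"
proof -
  have "(\<Sum>b\<in>N. S a b * x b) = (\<Sum>b\<in>N. S' a b * x b)"
    if "a \<in> insert i K" "\<forall>b\<in>N - insert j K. x b = 0" for a x
  proof (rule sum.cong)
    fix b assume "b \<in> N"
    with that assms[of a b] show "S a b * x b = S' a b * x b"
      by (cases "b \<in> insert j K") auto
  qed simp
  then show ?thesis
    unfolding singular_def by (intro ex_cong1) auto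
qed

text \<open>Vectors indexed by the positions in \<open>cs\<close> correspond to functions on
  \<open>N\<close> vanishing outside \<open>set cs\<close>; distinctness of \<open>cs\<close> makes
  this correspondence bijective.\<close>

lemma det_submatrix_of_eq_0_iff:
  assumes "finite N" "distinct cs" "set cs \<subseteq> N" "length rs = length cs"
  shows "det (submatrix_of S rs cs) = 0 \<longleftrightarrow>
    (\<exists>x. (\<exists>a\<in>N. x a \<noteq> 0) \<and> (\<forall>a\<in>N - set cs. x a = 0) \<and> (\<forall>a\<in>set rs. (\<Sum>b\<in>N. S a b * x b) = 0))"
    (is "_ \<longleftrightarrow> (\<exists>x. ?P x)")
proof -
  let ?n = "length cs"
  have A: "submatrix_of S rs cs \<in> carrier_mat ?n ?n"
    using assms by (simp add: submatrix_of_def)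
  have prod: "(submatrix_of S rs cs *\<^sub>v v) $ p = (\<Sum>b\<in>N. S (rs ! p) b * x b)"
    if v: "v \<in> carrier_vec ?n" and p: "p < ?n" and x: "\<forall>q<?n. v $ q = x (cs ! q)"
      "\<forall>a\<in>N - set cs. x a = 0" for v x p
  proof -
    have "(submatrix_of S rs cs *\<^sub>v v) $ p = (\<Sum>q<?n. S (rs ! p) (cs ! q) * x (cs ! q))"
      using v p x assms(4)
      by (auto simp: submatrix_of_def scalar_prod_def atLeast0LessThan intro!: sum.cong)
    also have "\<dots> = (\<Sum>b\<in>set cs. S (rs ! p) b * x b)"
      using sum.reindex_bij_betw[OF bij_betw_nth[OF assms(2) refl refl]] by simp
    also have "\<dots> = (\<Sum>b\<in>N. S (rs ! p) b * x b)"
      using assms x by (intro sum.mono_neutral_left) auto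
    finally show ?thesis .
  qed
  show ?thesis
    unfolding det_0_iff_vec_prod_zero_field[OF A]
  proof
    assume "\<exists>v. v \<in> carrier_vec ?n \<and> v \<noteq> 0\<^sub>v ?n \<and> submatrix_of S rs cs *\<^sub>v v = 0\<^sub>v ?n"
    then obtain v where v: "v \<in> carrier_vec ?n" "v \<noteq> 0\<^sub>v ?n" "submatrix_of S rs cs *\<^sub>v v = 0\<^sub>v ?n"
      by blast
    define x where "x b = (if b \<in> set cs then v $ (the_inv_into {..<?n} ((!) cs) b) else 0)" for b
    have x: "v $ q = x (cs ! q)" if "q < ?n" for q
      using that inj_on_nth[OF assms(2), of "{..<?n}"] by (simp add: x_def the_inv_into_f_f)
    obtain q where q: "q < ?n" "v $ q \<noteq> 0"
    proof (rule ccontr)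
      assume "\<not> thesis"
      then have "v = 0\<^sub>v ?n"
        using v(1) that by (intro eq_vecI) auto
      with v(2) show False ..
    qed
    have "\<exists>a\<in>N. x a \<noteq> 0"
    proof
      show "x (cs ! q) \<noteq> 0"
        using x q by simp
      show "cs ! q \<in> N"
        using q assms(3) nth_mem by blast
    qed
    moreover have zero: "\<forall>a\<in>N - set cs. x a = 0"
      by (simp add: x_def)
    moreover have "(\<Sum>b\<in>N. S a b * x b) = 0" if a: "a \<in> set rs" for a
    proof -
      obtain p where p: "p < ?n" "a = rs ! p"
        using a assms(4) by (auto simp: in_set_conv_nth)
      show ?thesis
        using prod[OF v(1) p(1) _ zero] x v(3) p by simp
    qed
    ultimately show "\<exists>x. ?P x"
      by blast
  next
    assume "\<exists>x. ?P x"
    then obtain x where x: "?P x" by blast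
    let ?v = "vec ?n (\<lambda>q. x (cs ! q))"
    obtain a where a: "a \<in> N" "x a \<noteq> 0"
      using x by blast
    then have "a \<in> set cs"
      using x by blast
    then obtain q where q: "q < ?n" "a = cs ! q"
      by (auto simp: in_set_conv_nth)
    have "?v $ q \<noteq> 0\<^sub>v ?n $ q"
      using a q by simp
    then have "?v \<noteq> 0\<^sub>v ?n"
      by metis
    moreover have "submatrix_of S rs cs *\<^sub>v ?v = 0\<^sub>v ?n"
    proof (rule eq_vecI)
      fix p assume "p < dim_vec (0\<^sub>v ?n :: real vec)"
      then have p: "p < ?n" by simp
      then show "(submatrix_of S rs cs *\<^sub>v ?v) $ p = 0\<^sub>v ?n $ p"
        using prod[of ?v p x] x assms(4) by simp
    qed (use assms in \<open>simp add: submatrix_of_def\<close>)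
    ultimately show "\<exists>v. v \<in> carrier_vec ?n \<and> v \<noteq> 0\<^sub>v ?n \<and> submatrix_of S rs cs *\<^sub>v v = 0\<^sub>v ?n"
      by (intro exI[of _ ?v]) simp
  qed
qed

lemma minor_eq_0_iff_singular:
  assumes "finite N" "i \<in> N" "j \<in> N" "i \<noteq> j" "K \<subseteq> N - {i, j}"
  shows "minor S (insert i K) (insert j K) = 0 \<longleftrightarrow> singular N S i j K"
proof -
  have fin: "finite K"
    using assms by (meson finite_Diff finite_subset)
  have notin: "i \<notin> K" "j \<notin> K"
    using assms by auto
  let ?ks = "enumeration K"
  note K = enumeration[OF fin]
  have "minor S (insert i K) (insert j K) = 0 \<longleftrightarrow> det (submatrix_of S (i # ?ks) (j # ?ks)) = 0"
    using K fin notin by (intro minor_eq_0_iff) auto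
  also have "\<dots> \<longleftrightarrow> singular N S i j K"
    unfolding singular_def
    using assms K by (subst det_submatrix_of_eq_0_iff[where N = N]) auto
  finally show ?thesis .
qed

lemma det_rational:
  assumes "\<And>p q. p < dim_row A \<Longrightarrow> q < dim_col A \<Longrightarrow> A $$ (p, q) \<in> \<rat>"
  shows "det A \<in> (\<rat> :: real set)"
proof (cases "dim_row A = dim_col A")
  case True
  have "(\<Prod>p = 0..<dim_row A. A $$ (p, \<pi> p)) \<in> \<rat>" if "\<pi> permutes {0..<dim_row A}" for \<pi>
  proof -
    have "\<pi> p < dim_row A" if "p < dim_row A" for p
      using \<open>\<pi> permutes _\<close> that permutes_in_image[of \<pi> _ p] by simp
    then show ?thesis
      using assms True by (intro Rats_prod) auto
  qed
  then show ?thesis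
    unfolding det_def using True by (auto intro!: Rats_sum Rats_mult simp: sign_def)
qed (simp add: det_def)

text \<open>Row \<open>k\<close> occurs once in the minor, so the minor is an affine function of the entry \<open>z\<close>,
  with slope the minor obtained by replacing row \<open>k\<close> by a unit vector.\<close>

lemma singular_solve_entry:
  assumes "finite N" "k \<in> N" "l \<in> N" "k \<noteq> l" "M \<subseteq> N - {k, l}" "c = l \<or> c \<in> M"
    and rational: "\<And>a b. a \<in> N \<Longrightarrow> b \<in> N \<Longrightarrow> S a b \<in> \<rat>"
    and nonsingular: "\<not> singular N (S(k := (\<lambda>b. of_bool (b = c)))) k l M"
  obtains z where "z \<in> \<rat>" "singular N (S(k := (S k)(c := z))) k l M"
proof -
  have fin: "finite M"
    using assms by (meson finite_Diff finite_subset)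
  define ms where "ms = enumeration M"
  define cs where "cs = l # ms"
  define n where "n = length cs"
  have cs: "distinct cs" "set cs = insert l M" and ms: "set ms = M"
    using assms enumeration[OF fin] by (auto simp: cs_def ms_def)
  define \<phi> where "\<phi> r = det (submatrix_of (S(k := r)) (k # ms) cs)" for r
  define cof where "cof q = cofactor (submatrix_of S (k # ms) cs) 0 q" for q
  have \<phi>: "\<phi> r = (\<Sum>q<n. r (cs ! q) * cof q)" for r
  proof -
    have len: "length (k # ms) = n"
      by (simp add: n_def cs_def)
    have "submatrix_of (S(k := r)) (k # ms) cs \<in> carrier_mat n n"
      using len by (simp add: submatrix_of_def n_def)
    moreover have "0 < n" by (simp add: n_def cs_def)
    moreover have "mat_delete (submatrix_of (S(k := r)) (k # ms) cs) 0 q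
      = mat_delete (submatrix_of S (k # ms) cs) 0 q" for q
    proof (rule eq_matI)
      fix p q' assume "p < dim_row (mat_delete (submatrix_of S (k # ms) cs) 0 q)"
        "q' < dim_col (mat_delete (submatrix_of S (k # ms) cs) 0 q)"
      then have "p < length ms" "q' < length cs - 1"
        by (simp_all add: mat_delete_def submatrix_of_def)
      moreover from this have "ms ! p \<noteq> k"
        using assms(5) ms nth_mem by fastforce
      ultimately show "mat_delete (submatrix_of (S(k := r)) (k # ms) cs) 0 q $$ (p, q')
        = mat_delete (submatrix_of S (k # ms) cs) 0 q $$ (p, q')"
        by (simp add: mat_delete_def submatrix_of_def)
    qed (simp_all add: mat_delete_def submatrix_of_def)
    ultimately show ?thesis
      unfolding \<phi>_def by (subst laplace_expansion_row[of _ n 0])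
        (auto simp: cof_def cofactor_def submatrix_of_def n_def intro!: sum.cong)
  qed
  have singular: "\<phi> r = 0 \<longleftrightarrow> singular N (S(k := r)) k l M" for r
    unfolding \<phi>_def singular_def using cs ms assms
    by (subst det_submatrix_of_eq_0_iff[where N = N]) (auto simp: cs_def)
  let ?e = "\<lambda>b. of_bool (b = c) :: real"
  have slope: "\<phi> ((S k)(c := z)) = \<phi> ((S k)(c := 0)) + z * \<phi> ?e" for z
    unfolding \<phi> sum_distrib_left sum.distrib[symmetric]
    by (rule sum.cong) (auto simp: algebra_simps)
  have rat: "\<phi> r \<in> \<rat>" if "\<And>b. b \<in> N \<Longrightarrow> r b \<in> \<rat>" for r
    unfolding \<phi>_def
  proof (rule det_rational)
    fix p q
    assume "p < dim_row (submatrix_of (S(k := r)) (k # ms) cs)"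
      "q < dim_col (submatrix_of (S(k := r)) (k # ms) cs)"
    then have "p < length (k # ms)" "q < length cs"
      by (simp_all add: submatrix_of_def)
    moreover from this have "(k # ms) ! p \<in> N" "cs ! q \<in> N"
      using nth_mem[of p "k # ms"] nth_mem[of q cs] cs ms assms by auto
    ultimately show "submatrix_of (S(k := r)) (k # ms) cs $$ (p, q) \<in> \<rat>"
      using that rational by (simp add: submatrix_of_def)
  qed
  \<comment> \<open>The zero of an affine function. Its value at 0 and its slope are determinants of
    rational matrices, hence \<open>z\<close> is rational.\<close>
  define z where "z = - \<phi> ((S k)(c := 0)) / \<phi> ?e"
  have "\<phi> ((S k)(c := z)) = 0"
    using slope[of z] nonsingular singular[of ?e] by (simp add: z_def)
  moreover have "z \<in> \<rat>"
    unfolding z_def using rational assms(2) by (intro Rats_divide Rats_minus_iff[THEN iffD2] rat) auto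
  ultimately show ?thesis
    using that singular by blast
qed

section \<open>Principal pivots\<close>

definition sign_symmetric :: "'a set \<Rightarrow> 'a set \<Rightarrow> ('a \<Rightarrow> 'a \<Rightarrow> real) \<Rightarrow> bool" where
  "sign_symmetric N T S \<longleftrightarrow>
     (\<forall>a\<in>N. \<forall>b\<in>N. S b a = (if a \<in> T \<longleftrightarrow> b \<in> T then S a b else - S a b))"

text \<open>With the diagonal sign \<open>\<eta>\<close>, equal to -1 on \<open>T\<close> and to 1
  elsewhere, the transpose of \<open>S\<close> is \<eta> S \<eta>. Multiplication by
  \<open>\<eta>\<close> therefore turns a kernel vector of the transposed submatrix into one of
  \<open>S\<close>.\<close>

lemma singular_sym:
  assumes "finite N" "sign_symmetric N T S" "i \<in> N" "j \<in> N" "i \<noteq> j" "K \<subseteq> N - {i, j}"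
    and "singular N S i j K"
  shows "singular N S j i K"
proof -
  have fin: "finite K"
    using assms by (meson finite_Diff finite_subset)
  have notin: "i \<notin> K" "j \<notin> K"
    using assms by auto
  let ?ks = "enumeration K"
  note K = enumeration[OF fin]
  have "det (submatrix_of S (i # ?ks) (j # ?ks)) = 0"
    using assms K notin by (subst det_submatrix_of_eq_0_iff[where N = N])
      (auto simp: singular_def)
  then have "det (submatrix_of (\<lambda>a b. S b a) (j # ?ks) (i # ?ks)) = 0"
    using det_submatrix_of_transpose[of "i # ?ks" "j # ?ks" S] by simp
  then have "singular N (\<lambda>a b. S b a) j i K"
    using assms K notin
    by (subst (asm) det_submatrix_of_eq_0_iff[where N = N]) (auto simp: singular_def)
  then obtain x where x: "\<exists>a\<in>N. x a \<noteq> 0" "\<And>a. a \<in> N \<Longrightarrow> a \<noteq> i \<Longrightarrow> a \<notin> K \<Longrightarrow> x a = 0"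
    "(\<Sum>b\<in>N. S b j * x b) = 0" "\<And>a. a \<in> K \<Longrightarrow> (\<Sum>b\<in>N. S b a * x b) = 0"
    by (rule singularE) blast
  define \<eta> where "\<eta> a = (if a \<in> T then -1 else 1 :: real)" for a
  have \<eta>: "\<eta> a \<noteq> 0" for a
    by (simp add: \<eta>_def)
  have "(\<Sum>b\<in>N. S a b * (\<eta> b * x b)) = \<eta> a * (\<Sum>b\<in>N. S b a * x b)" if "a \<in> N" for a
    unfolding sum_distrib_left
  proof (rule sum.cong)
    fix b assume "b \<in> N"
    then have "S b a = (if a \<in> T \<longleftrightarrow> b \<in> T then S a b else - S a b)"
      using that assms(2) unfolding sign_symmetric_def by blast
    then have "S b a = \<eta> a * \<eta> b * S a b"
      by (simp add: \<eta>_def)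
    moreover have "\<eta> a * \<eta> a = 1"
      by (simp add: \<eta>_def)
    ultimately show "S a b * (\<eta> b * x b) = \<eta> a * (S b a * x b)"
      by (metis (no_types, opaque_lifting) mult.assoc mult.commute mult_1)
  qed simp
  then show ?thesis
    using x \<eta> assms by (intro singularI[of _ "\<lambda>b. \<eta> b * x b"]) auto
qed

text \<open>The principal pivot transform, or partial inverse: the equations y = S x solved for
  \<open>x m\<close> in terms of \<open>y m\<close> and the other coordinates of x. Away from
  \<open>m\<close> it is the Schur complement.\<close>

definition pivot :: "'a \<Rightarrow> ('a \<Rightarrow> 'a \<Rightarrow> real) \<Rightarrow> 'a \<Rightarrow> 'a \<Rightarrow> real" where
  "pivot m S a b =
     (if a = m then if b = m then 1 / S m m else - S m b / S m m
      else if b = m then S a m / S m m else S a b - S a m * S m b / S m m)"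

lemma pivot_pivot:
  assumes "S m m \<noteq> 0"
  shows "pivot m (pivot m S) = S"
  using assms by (auto simp: pivot_def fun_eq_iff field_simps)

lemma sign_symmetric_pivot:
  assumes "sign_symmetric N (insert m T) S" "m \<in> N" "m \<notin> T"
  shows "sign_symmetric N T (pivot m S)"
  unfolding sign_symmetric_def
proof (intro ballI)
  fix a b assume ab: "a \<in> N" "b \<in> N"
  have S: "S q p = (if p \<in> insert m T \<longleftrightarrow> q \<in> insert m T then S p q else - S p q)"
    if "p \<in> N" "q \<in> N" for p q
    using assms(1) that by (auto simp: sign_symmetric_def)
  note S[of a b] S[of a m] S[of m b]
  then show "pivot m S b a = (if a \<in> T \<longleftrightarrow> b \<in> T then pivot m S a b else - pivot m S a b)"
    using ab assms(2,3) by (auto simp: pivot_def)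
qed

text \<open>The combined effect on statements of pivoting at every index of \<open>T\<close>. The
  indices of the pair never enter the conditioning set, so toggling by \<open>K\<close> makes
  \<open>(ij|K)\<close> unconditional.\<close>

definition toggle :: "'a set \<Rightarrow> 'a ci_stmt \<Rightarrow> 'a ci_stmt" where
  "toggle T s = (fst s, sym_diff (snd s) T - fst s)"

lemma toggle_ci: "toggle T (ci i j K) = ci i j (sym_diff K T - {i, j})"
  by (simp add: toggle_def)

text \<open>The graph of \<open>pivot m S\<close> arises from the graph \<open>{(x, S x)}\<close> by exchanging the \<open>m\<close>-th
  coordinates of argument and value; this exchanges the conditions that singularity
  imposes on an index inside and outside of \<open>K\<close>.\<close>

lemma pivot_graph:
  fixes S :: "'a \<Rightarrow> 'a \<Rightarrow> real" and x :: "'a \<Rightarrow> real"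
  assumes "finite N" "m \<in> N" "S m m \<noteq> 0" "a \<in> N"
  defines "y \<equiv> \<lambda>a. \<Sum>b\<in>N. S a b * x b"
  shows "(\<Sum>b\<in>N. pivot m S a b * (x(m := y m)) b) = (y(m := x m)) a"
proof -
  let ?r = "\<lambda>a. \<Sum>b\<in>N - {m}. S a b * x b"
  have y: "y a = S a m * x m + ?r a" for a
    unfolding y_def using assms by (simp add: sum.remove)
  have "(\<Sum>b\<in>N. pivot m S a b * (x(m := y m)) b) =
    pivot m S a m * y m + (\<Sum>b\<in>N - {m}. pivot m S a b * x b)"
    using assms by (simp add: sum.remove)
  also have "(\<Sum>b\<in>N - {m}. pivot m S a b * x b) =
    (if a = m then - ?r m / S m m else ?r a - S a m / S m m * ?r m)"
  proof (cases "a = m")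
    case True
    then show ?thesis
      by (auto simp: pivot_def sum_divide_distrib sum_negf[symmetric] intro!: sum.cong)
  next
    case False
    then show ?thesis
      by (auto simp: pivot_def sum_distrib_left sum_subtractf[symmetric] algebra_simps
        intro!: sum.cong)
  qed
  finally show ?thesis
    using assms(3) y by (auto simp: pivot_def field_simps)
qed

lemma singular_pivot_imp:
  assumes "finite N" "m \<in> N" "S m m \<noteq> 0" "i \<in> N" "j \<in> N" "i \<noteq> j" "K \<subseteq> N - {i, j}"
    and "singular N S i j K"
  shows "singular N (pivot m S) i j (sym_diff K {m} - {i, j})"
proof -
  obtain x where x: "\<exists>a\<in>N. x a \<noteq> 0" "\<And>a. a \<in> N \<Longrightarrow> a \<noteq> j \<Longrightarrow> a \<notin> K \<Longrightarrow> x a = 0"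
    "(\<Sum>b\<in>N. S i b * x b) = 0" "\<And>a. a \<in> K \<Longrightarrow> (\<Sum>b\<in>N. S a b * x b) = 0"
    using assms(8) by (rule singularE) blast
  define y where "y a = (\<Sum>b\<in>N. S a b * x b)" for a
  have graph: "(\<Sum>b\<in>N. pivot m S a b * (x(m := y m)) b) = (y(m := x m)) a" if "a \<in> N" for a
    unfolding y_def using pivot_graph[of N m S a x] assms that by simp
  show ?thesis
  proof (rule singularI)
    show "\<exists>a\<in>N. (x(m := y m)) a \<noteq> 0"
    \<comment> \<open>If the exchanged vector vanished, so would its image under the pivot, whose
      coordinate at \<open>m\<close> is \<open>x m\<close>; then \<open>x\<close> itself would
      vanish.\<close>
    proof (rule ccontr)
      assume *: "\<not> (\<exists>a\<in>N. (x(m := y m)) a \<noteq> 0)"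
      then have "(\<Sum>b\<in>N. pivot m S m b * (x(m := y m)) b) = 0"
        by (intro sum.neutral) auto
      with graph[OF assms(2)] have "x m = 0" by simp
      with * x(1) show False
        by (metis fun_upd_apply)
    qed
    show "(x(m := y m)) a = 0"
      if "a \<in> N" "a \<noteq> j" "a \<notin> sym_diff K {m} - {i, j}" for a
      using that x assms(6,7) by (auto simp: y_def)
    show "(\<Sum>b\<in>N. pivot m S a b * (x(m := y m)) b) = 0"
      if "a = i \<or> a \<in> sym_diff K {m} - {i, j}" for a
    proof -
      have "a \<in> N"
        using that assms by auto
      moreover have "(y(m := x m)) a = 0"
        using that x assms by (auto simp: y_def)
      ultimately show ?thesis
        using graph by simp
    qed
  qed
qed

lemma singular_pivot_iff:
  assumes "finite N" "m \<in> N" "S m m \<noteq> 0" "i \<in> N" "j \<in> N" "i \<noteq> j" "K \<subseteq> N - {i, j}"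
  shows "singular N (pivot m S) i j K \<longleftrightarrow> singular N S i j (sym_diff K {m} - {i, j})"
proof
  assume "singular N (pivot m S) i j K"
  with assms have "singular N (pivot m (pivot m S)) i j (sym_diff K {m} - {i, j})"
    by (intro singular_pivot_imp) (auto simp: pivot_def)
  with assms show "singular N S i j (sym_diff K {m} - {i, j})"
    by (simp add: pivot_pivot)
next
  assume "singular N S i j (sym_diff K {m} - {i, j})"
  with assms have "singular N (pivot m S) i j (sym_diff (sym_diff K {m} - {i, j}) {m} - {i, j})"
    by (intro singular_pivot_imp) auto
  moreover have "sym_diff (sym_diff K {m} - {i, j}) {m} - {i, j} = K"
    using assms(7) by auto
  ultimately show "singular N (pivot m S) i j K"
    by simp
qed

definition realizes :: "'a set \<Rightarrow> 'a set \<Rightarrow> 'a ci_stmt set \<Rightarrow> real \<Rightarrow> ('a \<Rightarrow> 'a \<Rightarrow> real) \<Rightarrow> bool" where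
  "realizes N T G d S \<longleftrightarrow> (\<forall>a\<in>N. \<forall>b\<in>N. S a b \<in> \<rat>) \<and> sign_symmetric N T S \<and>
     (\<forall>a\<in>N. \<forall>b\<in>N. \<bar>S a b - of_bool (a = b)\<bar> < d) \<and>
     (\<forall>i\<in>N. \<forall>j\<in>N. \<forall>K. i \<noteq> j \<and> K \<subseteq> N - {i, j} \<longrightarrow> (singular N S i j K \<longleftrightarrow> ci i j K \<in> G))"

text \<open>All distances are required at once because each pivot loses a constant factor in the
  distance from the identity.\<close>

definition realizable :: "'a set \<Rightarrow> 'a set \<Rightarrow> 'a ci_stmt set \<Rightarrow> bool" where
  "realizable N T G \<longleftrightarrow> (\<forall>d>0. \<exists>S. realizes N T G d S)"

text \<open>The pivot element exceeds 1/2, so division by it at most doubles an entry, and the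
  correction in the Schur complement is a product of two small entries.\<close>

lemma pivot_near_identity:
  assumes "m \<in> N" "a \<in> N" "b \<in> N" "0 < d" "d \<le> 1/2"
    and near: "\<And>a b. a \<in> N \<Longrightarrow> b \<in> N \<Longrightarrow> \<bar>S a b - of_bool (a = b)\<bar> < d"
  shows "\<bar>pivot m S a b - of_bool (a = b)\<bar> < 4 * d"
proof -
  have m: "\<bar>S m m - 1\<bar> < d" "S m m > 1/2"
    using near[of m m] assms by auto
  have quot: "\<bar>u / S m m\<bar> < 2 * d" if "\<bar>u\<bar> < d" for u
  proof -
    have "2 * d * (1/2) \<le> 2 * d * S m m"
      using m assms(4) by (intro mult_left_mono) auto
    with that have "\<bar>u\<bar> < 2 * d * S m m"
      by linarith
    with m show ?thesis
      by (simp add: pos_divide_less_eq)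
  qed
  consider "a = m" "b = m" | "a = m" "b \<noteq> m" | "a \<noteq> m" "b = m" | "a \<noteq> m" "b \<noteq> m" by blast
  then show ?thesis
  proof cases
    case 1
    then have "pivot m S a b - of_bool (a = b) = (1 - S m m) / S m m"
      using m by (simp add: pivot_def field_simps)
    with quot[of "1 - S m m"] m assms(4) show ?thesis
      by (simp add: abs_minus_commute)
  next
    case 2
    with quot[of "- S m b"] near[of m b] assms show ?thesis
      by (simp add: pivot_def)
  next
    case 3
    with quot[of "S a m"] near[of a m] assms show ?thesis
      by (simp add: pivot_def)
  next
    case 4
    have "\<bar>S a m / S m m\<bar> * \<bar>S m b\<bar> \<le> (2 * d) * (1/2)"
      using quot[of "S a m"] near[of a m] near[of m b] 4 assms by (intro mult_mono) auto
    then have "\<bar>S a m * S m b / S m m\<bar> \<le> d"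
      by (simp add: abs_mult)
    with near[OF assms(2,3)] assms(4)
    have "\<bar>S a b - S a m * S m b / S m m - of_bool (a = b)\<bar> < 4 * d"
      by linarith
    with 4 show ?thesis
      by (simp add: pivot_def)
  qed
qed

lemma realizable_pivot:
  assumes "finite N" "m \<in> N" "m \<notin> T" "realizable N (insert m T) (toggle {m} ` G)"
    and G: "\<And>p K. (p, K) \<in> G \<Longrightarrow> K \<inter> p = {}"
  shows "realizable N T G"
  unfolding realizable_def
proof (intro allI impI)
  fix d :: real assume "d > 0"
  \<comment> \<open>The bound 1/2 keeps the pivot element away from 0, and d / 4 compensates for the
    factor lost in \<open>pivot_near_identity\<close>.\<close>
  define d' where "d' = min (1/2) (d / 4)"
  have d': "d' > 0" "d' \<le> 1/2" "4 * d' \<le> d"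
    using \<open>d > 0\<close> by (auto simp: d'_def)
  obtain S where real: "realizes N (insert m T) (toggle {m} ` G) d' S"
    using assms(4) d'(1) unfolding realizable_def by blast
  have S: "\<forall>a\<in>N. \<forall>b\<in>N. S a b \<in> \<rat>" "sign_symmetric N (insert m T) S"
    "\<And>a b. a \<in> N \<Longrightarrow> b \<in> N \<Longrightarrow> \<bar>S a b - of_bool (a = b)\<bar> < d'"
    "\<And>i j K. i \<in> N \<Longrightarrow> j \<in> N \<Longrightarrow> i \<noteq> j \<Longrightarrow> K \<subseteq> N - {i, j} \<Longrightarrow>
      singular N S i j K \<longleftrightarrow> ci i j K \<in> toggle {m} ` G"
    using real unfolding realizes_def by blast+
  have "\<bar>S m m - 1\<bar> < d'"
    using S(3)[of m m] assms(2) by simp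
  then have m: "S m m \<noteq> 0"
    using d' by auto
  have "\<forall>a\<in>N. \<forall>b\<in>N. pivot m S a b \<in> \<rat>"
    using S(1) assms(2) by (auto simp: pivot_def)
  moreover have "\<forall>a\<in>N. \<forall>b\<in>N. \<bar>pivot m S a b - of_bool (a = b)\<bar> < d"
    using pivot_near_identity[OF assms(2) _ _ d'(1,2) S(3)] d'(3) by (meson less_le_trans)
  moreover have "singular N (pivot m S) i j K \<longleftrightarrow> ci i j K \<in> G"
    if "i \<in> N" "j \<in> N" "i \<noteq> j" "K \<subseteq> N - {i, j}" for i j K
  proof -
    have "singular N (pivot m S) i j K \<longleftrightarrow> singular N S i j (sym_diff K {m} - {i, j})"
      using assms(1,2) m that by (intro singular_pivot_iff)
    also have "\<dots> \<longleftrightarrow> ci i j (sym_diff K {m} - {i, j}) \<in> toggle {m} ` G"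
      using that assms(2) by (intro S(4)) auto
    also have "\<dots> \<longleftrightarrow> ci i j K \<in> G"
    proof
      assume "ci i j (sym_diff K {m} - {i, j}) \<in> toggle {m} ` G"
      then obtain s where s: "s \<in> G" "toggle {m} s = ci i j (sym_diff K {m} - {i, j})"
        by auto
      then obtain K' where K': "s = ci i j K'"
        by (cases s) (auto simp: toggle_def)
      have "sym_diff K' {m} - {i, j} = sym_diff K {m} - {i, j}"
        using s(2) unfolding K' toggle_ci by simp
      \<comment> \<open>Toggling forgets which indices of the pair lie in the conditioning set; it
        is injective on \<open>G\<close> only because there are none.\<close>
      moreover have "K' \<inter> {i, j} = {}"
        using G s(1) K' by simp
      ultimately have "K' = K"
        using that(4) by auto
      then show "ci i j K \<in> G"
        using s(1) K' by simp
    next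
      assume "ci i j K \<in> G"
      then show "ci i j (sym_diff K {m} - {i, j}) \<in> toggle {m} ` G"
        unfolding toggle_ci[symmetric] by (rule imageI)
    qed
    finally show ?thesis .
  qed
  ultimately have "realizes N T G d (pivot m S)"
    unfolding realizes_def using sign_symmetric_pivot[OF S(2) assms(2,3)] by blast
  then show "\<exists>S. realizes N T G d S"
    by blast
qed

text \<open>Every pivot at an index of \<open>T\<close> removes this index from the sign pattern and
  from the toggling at the same time. When \<open>T\<close> is exhausted, the matrix is truly
  symmetric.\<close>

lemma realizable_toggle:
  assumes "finite N" "T \<subseteq> N" "realizable N T (toggle T ` G)"
    and G: "\<And>p K. (p, K) \<in> G \<Longrightarrow> K \<inter> p = {}"
  shows "realizable N {} G"
proof -
  have "finite T"
    using assms finite_subset by blast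
  then show ?thesis
    using assms(2,3)
  proof (induction T)
    case empty
    have "toggle {} s = s" if "s \<in> G" for s
    proof -
      obtain p K where s: "s = (p, K)" by (cases s)
      with that G have "K \<inter> p = {}" by simp
      then show ?thesis
        unfolding s by (auto simp: toggle_def)
    qed
    then show ?case
      using empty by simp
  next
    case (insert m T)
    have "toggle (insert m T) s = toggle {m} (toggle T s)" for s
      using insert.hyps by (auto simp: toggle_def)
    then have "toggle (insert m T) ` G = toggle {m} ` toggle T ` G"
      by (auto simp: image_iff)
    moreover have "(p, K) \<in> toggle T ` G \<Longrightarrow> K \<inter> p = {}" for p K
      by (auto simp: toggle_def)
    ultimately have "realizable N T (toggle T ` G)"
      using realizable_pivot[OF assms(1), of m T "toggle T ` G"] insert by auto
    then show ?case
      using insert by auto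
  qed
qed

section \<open>Matrices near the identity\<close>

text \<open>By 2 |x a x b| \<le> (x a)^2 + (x b)^2, the deviation from the identity changes the
  quadratic form by at most \<open>card N * d\<close>, hence at most one half, times the sum of
  squares.\<close>

lemma positive_definite_near_identity:
  assumes "finite N" "real (card N) * d \<le> 1/2"
    and near: "\<And>a b. a \<in> N \<Longrightarrow> b \<in> N \<Longrightarrow> \<bar>S a b - of_bool (a = b)\<bar> < d"
  shows "positive_definite N S"
  unfolding positive_definite_def
proof (intro allI impI)
  fix x :: "'a \<Rightarrow> real" assume "\<exists>a\<in>N. x a \<noteq> 0"
  then obtain c where c: "c \<in> N" "x c \<noteq> 0" by blast
  let ?q = "\<Sum>a\<in>N. (x a)\<^sup>2"
  have q: "?q > 0"
    using c assms(1) by (intro sum_pos2[of _ c]) auto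
  have d: "d > 0"
    using near[OF c(1) c(1)] by linarith
  have entry: "x a * S a b * x b \<ge> of_bool (a = b) * (x a)\<^sup>2 - d * ((x a)\<^sup>2 + (x b)\<^sup>2) / 2"
    if "a \<in> N" "b \<in> N" for a b
  proof -
    let ?e = "S a b - of_bool (a = b)"
    have "\<bar>x a * x b\<bar> \<le> ((x a)\<^sup>2 + (x b)\<^sup>2) / 2"
      using sum_squares_bound[of "\<bar>x a\<bar>" "\<bar>x b\<bar>"] by (simp add: abs_mult)
    then have "\<bar>?e\<bar> * \<bar>x a * x b\<bar> \<le> d * (((x a)\<^sup>2 + (x b)\<^sup>2) / 2)"
      using near[OF that] d by (intro mult_mono) auto
    then have "?e * (x a * x b) \<ge> - (d * ((x a)\<^sup>2 + (x b)\<^sup>2) / 2)"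
      by (simp add: abs_mult[symmetric])
    moreover have "x a * S a b * x b = of_bool (a = b) * (x a)\<^sup>2 + ?e * (x a * x b)"
      by (auto simp: algebra_simps power2_eq_square)
    ultimately show ?thesis
      by linarith
  qed
  have "(\<Sum>a\<in>N. \<Sum>b\<in>N. x a * S a b * x b) \<ge>
    (\<Sum>a\<in>N. \<Sum>b\<in>N. of_bool (a = b) * (x a)\<^sup>2 - d * ((x a)\<^sup>2 + (x b)\<^sup>2) / 2)"
    using entry by (intro sum_mono)
  also have "(\<Sum>a\<in>N. \<Sum>b\<in>N. of_bool (a = b) * (x a)\<^sup>2 - d * ((x a)\<^sup>2 + (x b)\<^sup>2) / 2) =
    ?q - real (card N) * d * ?q"
  proof -
    have "(\<Sum>a\<in>N. \<Sum>b\<in>N. of_bool (a = b) * (x a)\<^sup>2) = ?q"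
    proof (rule sum.cong)
      fix a assume "a \<in> N"
      have "(\<Sum>b\<in>N. of_bool (a = b) * (x a)\<^sup>2) = (\<Sum>b\<in>N. if b = a then (x a)\<^sup>2 else 0)"
        by (rule sum.cong) auto
      with \<open>a \<in> N\<close> show "(\<Sum>b\<in>N. of_bool (a = b) * (x a)\<^sup>2) = (x a)\<^sup>2"
        using assms(1) by simp
    qed simp
    moreover have "(\<Sum>a\<in>N. \<Sum>b\<in>N. d * ((x a)\<^sup>2 + (x b)\<^sup>2) / 2) = real (card N) * d * ?q"
      by (simp add: sum_divide_distrib[symmetric] sum_distrib_left[symmetric] sum.distrib)
    ultimately show ?thesis
      by (simp add: sum_subtractf)
  qed
  finally show "(\<Sum>a\<in>N. \<Sum>b\<in>N. x a * S a b * x b) > 0"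
    using q mult_right_mono[OF assms(2), of ?q] by linarith
qed

text \<open>One half of the equivalence of norms in finite dimension: expand in matrix units and
  apply the triangle inequality.\<close>

lemma norm_on_matrices_bound:
  assumes "finite N" "norm_on_matrices N nrm"
  obtains c where "c > 0" "\<And>A d. A \<in> matrices N \<Longrightarrow> (\<And>a b. a \<in> N \<Longrightarrow> b \<in> N \<Longrightarrow> \<bar>A a b\<bar> < d) \<Longrightarrow>
    d > 0 \<Longrightarrow> nrm A < c * d"
proof -
  define E where "E p = (\<lambda>a b. of_bool (p = (a, b)) :: real)" for p :: "'a \<times> 'a"
  have E: "E p \<in> matrices N" if "p \<in> N \<times> N" for p
    using that by (auto simp: matrices_def E_def)
  have scale: "nrm (\<lambda>a b. c * A a b) = \<bar>c\<bar> * nrm A" if "A \<in> matrices N" for A c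
    using assms(2) that unfolding norm_on_matrices_def by blast
  have triangle: "nrm (\<lambda>a b. A a b + B a b) \<le> nrm A + nrm B"
    if "A \<in> matrices N" "B \<in> matrices N" for A B
    using assms(2) that unfolding norm_on_matrices_def by blast
  have nonneg: "nrm A \<ge> 0" if "A \<in> matrices N" for A
    using assms(2) that unfolding norm_on_matrices_def by blast
  have zero: "nrm (\<lambda>a b. 0) = 0"
    using assms(2) unfolding norm_on_matrices_def by (auto simp: matrices_def)
  have bound: "nrm (\<lambda>a b. \<Sum>p\<in>P. A (fst p) (snd p) * E p a b) \<le> (\<Sum>p\<in>P. \<bar>A (fst p) (snd p)\<bar> * nrm (E p))"
    if "P \<subseteq> N \<times> N" "finite P" for P A
    using that(2,1)
  proof (induction P)
    case (insert p P)
    let ?B = "\<lambda>a b. \<Sum>p\<in>P. A (fst p) (snd p) * E p a b"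
    have mat: "?B \<in> matrices N" "(\<lambda>a b. A (fst p) (snd p) * E p a b) \<in> matrices N"
      using insert.prems by (auto simp: matrices_def E_def intro!: sum.neutral)
    have "nrm (\<lambda>a b. A (fst p) (snd p) * E p a b + ?B a b) \<le>
      nrm (\<lambda>a b. A (fst p) (snd p) * E p a b) + nrm ?B"
      using mat by (intro triangle)
    moreover have "nrm (\<lambda>a b. A (fst p) (snd p) * E p a b) = \<bar>A (fst p) (snd p)\<bar> * nrm (E p)"
      using insert.prems by (intro scale E) auto
    ultimately show ?case
      using insert by simp
  qed (simp add: zero)
  \<comment> \<open>The summand 1 keeps the constant positive and the final estimate strict, also
    for empty \<open>N\<close>.\<close>
  define c where "c = 1 + (\<Sum>p\<in>N \<times> N. nrm (E p))"
  have sum_nonneg: "(\<Sum>p\<in>N \<times> N. nrm (E p)) \<ge> 0"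
    using E nonneg by (intro sum_nonneg) auto
  show thesis
  proof
    show "c > 0"
      using sum_nonneg by (simp add: c_def)
    fix A d
    assume A: "A \<in> matrices N" "\<And>a b. a \<in> N \<Longrightarrow> b \<in> N \<Longrightarrow> \<bar>A a b\<bar> < d" "d > 0"
    have "(\<lambda>a b. \<Sum>p\<in>N \<times> N. A (fst p) (snd p) * E p a b) = A"
    proof (intro ext)
      fix a b
      have "(\<Sum>p\<in>N \<times> N. A (fst p) (snd p) * E p a b) =
        (\<Sum>p\<in>N \<times> N. if p = (a, b) then A a b else 0)"
        by (rule sum.cong) (auto simp: E_def)
      also have "\<dots> = A a b"
        using A(1) assms(1) by (auto simp: matrices_def)
      finally show "(\<Sum>p\<in>N \<times> N. A (fst p) (snd p) * E p a b) = A a b" .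
    qed
    then have "nrm A \<le> (\<Sum>p\<in>N \<times> N. \<bar>A (fst p) (snd p)\<bar> * nrm (E p))"
      using bound[of "N \<times> N" A] assms(1) by simp
    also have "\<dots> \<le> (\<Sum>p\<in>N \<times> N. d * nrm (E p))"
      using A(2) E nonneg by (intro sum_mono mult_right_mono) (auto intro: less_imp_le)
    also have "\<dots> < c * d"
      using A(3) by (simp add: c_def sum_distrib_left[symmetric] algebra_simps)
    finally show "nrm A < c * d" .
  qed
qed

lemma realizable_conclusion:
  assumes "finite N" "norm_on_matrices N nrm" "\<epsilon> > 0" "G \<subseteq> ci_statements N" "realizable N {} G"
  shows "\<exists>S\<in>matrices N. symmetric_matrix N S \<and> positive_definite N S \<and>
    (\<forall>a\<in>N. \<forall>b\<in>N. S a b \<in> \<rat>) \<and>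
    nrm (\<lambda>a b. S a b - identity_matrix N a b) < \<epsilon> \<and> ci_structure N S = G"
proof -
  obtain c where c: "c > 0" "\<And>A d. A \<in> matrices N \<Longrightarrow>
    (\<And>a b. a \<in> N \<Longrightarrow> b \<in> N \<Longrightarrow> \<bar>A a b\<bar> < d) \<Longrightarrow> d > 0 \<Longrightarrow> nrm A < c * d"
    using norm_on_matrices_bound[OF assms(1,2)] by blast
  \<comment> \<open>The first bound controls the given norm, the second yields positive
    definiteness; the added 1 avoids a zero denominator for empty \<open>N\<close>.\<close>
  define d where "d = min (\<epsilon> / c) (1 / (2 * (real (card N) + 1)))"
  have "0 < 2 * (real (card N) + 1)"
    by (simp add: add_nonneg_pos)
  then have d: "d > 0" "c * d \<le> \<epsilon>"
    using c(1) assms(3) by (auto simp: d_def min_def field_simps)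
  have "real (card N) * d \<le> real (card N) * (1 / (2 * (real (card N) + 1)))"
    by (intro mult_left_mono) (auto simp: d_def)
  also have "\<dots> \<le> 1/2"
    by (simp add: field_simps)
  finally have card: "real (card N) * d \<le> 1/2" .
  obtain S0 where S0: "realizes N {} G d S0"
    using assms(5) d(1) unfolding realizable_def by blast
  \<comment> \<open>\<open>realizes\<close> says nothing about entries outside \<open>N\<close>,
    which have to be 0 in \<open>matrices N\<close>.\<close>
  define S where "S = (\<lambda>a b. if a \<in> N \<and> b \<in> N then S0 a b else 0)"
  have near: "\<bar>S a b - of_bool (a = b)\<bar> < d" if "a \<in> N" "b \<in> N" for a b
    using S0 that unfolding realizes_def S_def by simp
  have sing: "singular N S i j K \<longleftrightarrow> ci i j K \<in> G"
    if ij: "i \<in> N" "j \<in> N" "i \<noteq> j" "K \<subseteq> N - {i, j}" for i j K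
  proof -
    have "singular N S i j K \<longleftrightarrow> singular N S0 i j K"
      using ij by (intro singular_cong) (auto simp: S_def)
    then show ?thesis
      using S0 ij unfolding realizes_def by blast
  qed
  have "ci_structure N S = G"
  proof
    show "ci_structure N S \<subseteq> G"
      unfolding ci_structure_def using minor_eq_0_iff_singular[OF assms(1)] sing by auto
    show "G \<subseteq> ci_structure N S"
    proof
      fix s assume "s \<in> G"
      then obtain i j K where "s = ci i j K" "i \<in> N" "j \<in> N" "i \<noteq> j" "K \<subseteq> N - {i, j}"
        using assms(4) unfolding ci_statements_def by blast
      moreover from this have "minor S (insert i K) (insert j K) = 0"
        using \<open>s \<in> G\<close> minor_eq_0_iff_singular[OF assms(1)] sing by simp
      ultimately show "s \<in> ci_structure N S"
        unfolding ci_structure_def by blast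
    qed
  qed
  moreover have "S \<in> matrices N"
    by (simp add: S_def matrices_def)
  moreover have "symmetric_matrix N S" "\<forall>a\<in>N. \<forall>b\<in>N. S a b \<in> \<rat>"
    using S0 by (auto simp: realizes_def sign_symmetric_def symmetric_matrix_def S_def)
  moreover have "positive_definite N S"
    using positive_definite_near_identity[OF assms(1) card near] .
  moreover have "nrm (\<lambda>a b. S a b - identity_matrix N a b) < \<epsilon>"
  proof -
    have "nrm (\<lambda>a b. S a b - identity_matrix N a b) < c * d"
    proof (rule c(2))
      show "\<bar>S a b - identity_matrix N a b\<bar> < d" if "a \<in> N" "b \<in> N" for a b
        using near[OF that] that by (auto simp: identity_matrix_def split: if_splits)
    qed (use d in \<open>auto simp: matrices_def S_def identity_matrix_def\<close>)
    with d(2) show ?thesis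
      by linarith
  qed
  ultimately show ?thesis
    by blast
qed

section \<open>Second-order expansion\<close>

text \<open>The term with the largest exponent e dominates: the smaller distinct powers of 3 add up
  to at most (3^e - 1) / 2 in absolute value.\<close>

lemma signed_power_sum_ge_1:
  fixes s :: "'a \<Rightarrow> real" and e :: "'a \<Rightarrow> nat"
  assumes "finite D" "D \<noteq> {}" "inj_on e D" and s: "\<And>c. c \<in> D \<Longrightarrow> \<bar>s c\<bar> = 3 ^ e c"
  shows "1 \<le> \<bar>\<Sum>c\<in>D. s c\<bar>"
proof -
  have "Max (e ` D) \<in> e ` D"
    using assms by (intro Max_in) auto
  then obtain m where m: "m \<in> D" "e m = Max (e ` D)" by auto
  have "\<bar>\<Sum>c\<in>D - {m}. s c\<bar> \<le> (\<Sum>c\<in>D - {m}. \<bar>s c\<bar>)"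
    by (rule sum_abs)
  also have "\<dots> = (\<Sum>c\<in>D - {m}. 3 ^ e c)"
    using s by (intro sum.cong) auto
  also have "\<dots> = (\<Sum>k\<in>e ` (D - {m}). 3 ^ k)"
    using assms(3) by (subst sum.reindex) (auto intro: inj_on_subset)
  also have "\<dots> \<le> (\<Sum>k<e m. 3 ^ k)"
  proof (rule sum_mono2)
    show "e ` (D - {m}) \<subseteq> {..<e m}"
    proof
      fix k assume "k \<in> e ` (D - {m})"
      then obtain c where c: "c \<in> D" "c \<noteq> m" "k = e c" by auto
      have "e c \<le> e m"
        using c m assms by simp
      moreover have "e c \<noteq> e m"
        using c m(1) inj_onD[OF assms(3)] by blast
      ultimately show "k \<in> {..<e m}"
        using c by simp
    qed
  qed auto
  also have "\<dots> = (3 ^ e m - 1) / 2"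
    using geometric_sum[of "3 :: real" "e m"] by simp
  finally have "\<bar>\<Sum>c\<in>D - {m}. s c\<bar> \<le> (3 ^ e m - 1) / 2" .
  moreover have "(\<Sum>c\<in>D. s c) = s m + (\<Sum>c\<in>D - {m}. s c)"
    using assms m by (simp add: sum.remove)
  ultimately have "3 ^ e m \<le> \<bar>\<Sum>c\<in>D. s c\<bar> + (3 ^ e m - 1) / 2"
    using s[OF m(1)] by linarith
  moreover have "(1 :: real) \<le> 3 ^ e m"
    by simp
  ultimately show ?thesis
    by argo
qed

text \<open>Row \<open>c\<close> says that \<open>x c\<close> equals \<open>- S c b * x b\<close> up
  to off-diagonal terms. Applied to the largest coordinate on \<open>C\<close>, this bounds all of
  them to first order; substituting that bound leaves a second-order error. Only the rows in
  \<open>C\<close> are used, so any further row may be altered freely.\<close>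

lemma kernel_approx:
  assumes "finite N" "b \<in> N" "C \<subseteq> N - {b}" "0 \<le> d" "real (card N) * d \<le> 1/2"
    and diag: "\<And>c. c \<in> C \<Longrightarrow> S c c = 1"
    and off: "\<And>c e. c \<in> C \<Longrightarrow> e = b \<or> e \<in> C \<Longrightarrow> c \<noteq> e \<Longrightarrow> \<bar>S c e\<bar> \<le> d"
    and x: "\<exists>a\<in>N. x a \<noteq> 0" "\<And>a. a \<in> N \<Longrightarrow> a \<noteq> b \<Longrightarrow> a \<notin> C \<Longrightarrow> x a = 0"
      "\<And>a. a \<in> C \<Longrightarrow> (\<Sum>e\<in>N. S a e * x e) = 0"
  shows "x b \<noteq> 0" "\<And>c. c \<in> C \<Longrightarrow> \<bar>x c / x b + S c b\<bar> \<le> 2 * real (card N) * d\<^sup>2"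
proof -
  let ?n = "real (card N)"
  have C: "finite C" "C \<subseteq> N" "b \<notin> C"
    using assms(1-3) by (auto intro: finite_subset)
  have card: "real (card (C - A)) \<le> ?n" for A
    using C assms(1) by (intro of_nat_mono card_mono) auto
  have eq: "S c b * x b + x c + (\<Sum>e\<in>C - {c}. S c e * x e) = 0" if "c \<in> C" for c
  proof -
    have "(\<Sum>e\<in>N. S c e * x e) = (\<Sum>e\<in>insert b C. S c e * x e)"
      using assms C x(2) by (intro sum.mono_neutral_right) auto
    also have "\<dots> = S c b * x b + (S c c * x c + (\<Sum>e\<in>C - {c}. S c e * x e))"
      using C that by (simp add: sum.remove)
    finally show ?thesis
      using x(3)[OF that] diag[OF that] by simp
  qed
  have "x b \<noteq> 0 \<and> (\<forall>c\<in>C. \<bar>x c / x b + S c b\<bar> \<le> 2 * ?n * d\<^sup>2)"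
  proof (cases "C = {}")
    case True
    then have "x b \<noteq> 0"
      using x(1,2) by blast
    with True show ?thesis
      by simp
  next
    case False
    define m where "m = Max ((\<lambda>c. \<bar>x c\<bar>) ` C)"
    have m: "\<bar>x c\<bar> \<le> m" if "c \<in> C" for c
      unfolding m_def using C that by (intro Max_ge) auto
    have "m \<in> (\<lambda>c. \<bar>x c\<bar>) ` C"
      unfolding m_def using C False by (intro Max_in) auto
    then obtain c0 where c0: "c0 \<in> C" "m = \<bar>x c0\<bar>" by auto
    have dist: "\<bar>x c + S c b * x b\<bar> \<le> ?n * d * m" if c: "c \<in> C" for c
    proof -
      have "\<bar>\<Sum>e\<in>C - {c}. S c e * x e\<bar> \<le> (\<Sum>e\<in>C - {c}. \<bar>S c e\<bar> * \<bar>x e\<bar>)"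
        by (metis (no_types, lifting) abs_mult sum.cong sum_abs)
      also have "\<dots> \<le> (\<Sum>e\<in>C - {c}. d * m)"
        using off[OF c] m assms(4) by (intro sum_mono mult_mono) auto
      also have "\<dots> = real (card (C - {c})) * (d * m)"
        by simp
      also have "\<dots> \<le> ?n * (d * m)"
        using card[of "{c}"] assms(4) c0 by (intro mult_right_mono) auto
      finally show ?thesis
        using eq[OF c] by simp
    qed
    have "\<bar>S c0 b * x b\<bar> \<le> d * \<bar>x b\<bar>"
      unfolding abs_mult using off[OF c0(1)] C c0 by (intro mult_right_mono) auto
    moreover have "?n * d * m \<le> 1/2 * m"
      using assms(5) c0 by (intro mult_right_mono) auto
    \<comment> \<open>At the index \<open>c0\<close> of the maximum, m is at most d |x b| + m /
      2.\<close>
    ultimately have mb: "m \<le> 2 * d * \<bar>x b\<bar>"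
      using dist[OF c0(1)] c0(2) by linarith
    have b: "x b \<noteq> 0"
    proof
      assume "x b = 0"
      then have "x c = 0" if "c \<in> C" for c
        using m[OF that] mb by simp
      with \<open>x b = 0\<close> x(1,2) show False by blast
    qed
    moreover have "\<bar>x c / x b + S c b\<bar> \<le> 2 * ?n * d\<^sup>2" if c: "c \<in> C" for c
    proof -
      have "\<bar>x c / x b + S c b\<bar> = \<bar>x c + S c b * x b\<bar> / \<bar>x b\<bar>"
        using b by (simp only: abs_divide[symmetric]) (simp add: add_divide_distrib)
      also have "\<dots> \<le> (?n * d * (2 * d * \<bar>x b\<bar>)) / \<bar>x b\<bar>"
        using dist[OF c] mult_left_mono[OF mb, of "?n * d"] assms(4)
        by (intro divide_right_mono) auto
      also have "\<dots> = 2 * ?n * d\<^sup>2"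
        using b by (simp add: power2_eq_square)
      finally show ?thesis .
    qed
    ultimately show ?thesis by blast
  qed
  then show "x b \<noteq> 0" "\<And>c. c \<in> C \<Longrightarrow> \<bar>x c / x b + S c b\<bar> \<le> 2 * ?n * d\<^sup>2"
    by auto
qed

text \<open>The kernel vector is normalised to have coordinate 1 at \<open>b\<close>. For
  \<open>a\<close> outside \<open>C\<close> no entry of row \<open>a\<close> is bounded, so that row
  may contain an entry still to be estimated.\<close>

lemma singular_approx_vector:
  assumes "finite N" "b \<in> N" "C \<subseteq> N - {b}" "0 \<le> d" "real (card N) * d \<le> 1/2"
    and diag: "\<And>c. c \<in> C \<Longrightarrow> S c c = 1"
    and off: "\<And>c e. c \<in> C \<Longrightarrow> e = b \<or> e \<in> C \<Longrightarrow> c \<noteq> e \<Longrightarrow> \<bar>S c e\<bar> \<le> d"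
    and "singular N S a b C"
  obtains w where "S a b + (\<Sum>c\<in>C. S a c * w c) = 0"
    "\<And>c. c \<in> C \<Longrightarrow> \<bar>w c + S c b\<bar> \<le> 2 * real (card N) * d\<^sup>2"
proof -
  obtain x where x: "\<exists>a\<in>N. x a \<noteq> 0" "\<And>a. a \<in> N \<Longrightarrow> a \<noteq> b \<Longrightarrow> a \<notin> C \<Longrightarrow> x a = 0"
    "(\<Sum>e\<in>N. S a e * x e) = 0" "\<And>a. a \<in> C \<Longrightarrow> (\<Sum>e\<in>N. S a e * x e) = 0"
    using assms(8) by (rule singularE) blast
  have approx: "x b \<noteq> 0" "\<And>c. c \<in> C \<Longrightarrow> \<bar>x c / x b + S c b\<bar> \<le> 2 * real (card N) * d\<^sup>2"
    using kernel_approx[where S = S, OF assms(1-5) diag off x(1,2,4)] by blast+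
  have C: "finite C" "C \<subseteq> N" "b \<notin> C"
    using assms(1-3) by (auto intro: finite_subset)
  have "(\<Sum>e\<in>N. S a e * x e) = (\<Sum>e\<in>insert b C. S a e * x e)"
    using assms(1-3) C x(2) by (intro sum.mono_neutral_right) auto
  then have "S a b * x b + (\<Sum>c\<in>C. S a c * x c) = 0"
    using C x(3) by simp
  then have "(S a b * x b + (\<Sum>c\<in>C. S a c * x c)) / x b = 0"
    by simp
  then have "S a b + (\<Sum>c\<in>C. S a c * (x c / x b)) = 0"
    using approx(1) by (simp add: add_divide_distrib sum_divide_distrib)
  then show thesis
    using approx(2) by (intro that[of "\<lambda>c. x c / x b"])
qed

text \<open>Replacing the normalised kernel vector by \<open>- S c b\<close> costs a second-order
  error, multiplied by a first-order entry of row \<open>a\<close>. For \<open>a\<close> outside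
  \<open>C\<close>, nothing is assumed about \<open>S a b\<close>, which may be the unknown.\<close>

lemma singular_approx:
  assumes "finite N" "b \<in> N" "C \<subseteq> N - {b}" "0 \<le> d" "real (card N) * d \<le> 1/2"
    and diag: "\<And>c. c \<in> C \<Longrightarrow> S c c = 1"
    and off: "\<And>c e. c \<in> C \<Longrightarrow> e = b \<or> e \<in> C \<Longrightarrow> c \<noteq> e \<Longrightarrow> \<bar>S c e\<bar> \<le> d"
    and row: "\<And>c. c \<in> C \<Longrightarrow> \<bar>S a c\<bar> \<le> d"
    and "singular N S a b C"
  shows "\<bar>S a b - (\<Sum>c\<in>C. S a c * S c b)\<bar> \<le> 2 * (real (card N))\<^sup>2 * d ^ 3"
proof -
  let ?n = "real (card N)"
  obtain w where w: "S a b + (\<Sum>c\<in>C. S a c * w c) = 0"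
    "\<And>c. c \<in> C \<Longrightarrow> \<bar>w c + S c b\<bar> \<le> 2 * ?n * d\<^sup>2"
    using singular_approx_vector[OF assms(1-5) diag off assms(9)] by blast
  have "\<bar>S a b - (\<Sum>c\<in>C. S a c * S c b)\<bar> = \<bar>\<Sum>c\<in>C. S a c * (w c + S c b)\<bar>"
    using w(1) by (simp add: algebra_simps sum.distrib)
  also have "\<dots> \<le> (\<Sum>c\<in>C. \<bar>S a c\<bar> * \<bar>w c + S c b\<bar>)"
    by (metis (no_types, lifting) abs_mult sum.cong sum_abs)
  also have "\<dots> \<le> (\<Sum>c\<in>C. d * (2 * ?n * d\<^sup>2))"
    using w(2) row assms(4) by (intro sum_mono mult_mono) auto
  also have "\<dots> = real (card C) * (d * (2 * ?n * d\<^sup>2))"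
    by simp
  also have "\<dots> \<le> ?n * (d * (2 * ?n * d\<^sup>2))"
    using assms(1,3,4) by (intro mult_right_mono of_nat_mono card_mono) auto
  also have "\<dots> = 2 * ?n\<^sup>2 * d ^ 3"
    by (simp add: power2_eq_square power3_eq_cube)
  finally show ?thesis .
qed

text \<open>This is the slope condition of \<open>singular_solve_entry\<close>. The unit row forces
  \<open>x c = 0\<close>, whereas x c / x l is close to \<open>- S c l\<close>, which exceeds the
  approximation error; for \<open>c = l\<close> already \<open>x l\<close> cannot vanish.\<close>

lemma nonsingular_unit_row:
  assumes "finite N" "l \<in> N" "M \<subseteq> N - {l}" "0 \<le> d" "real (card N) * d \<le> 1/2"
    and diag: "\<And>c. c \<in> M \<Longrightarrow> S c c = 1"
    and off: "\<And>c e. c \<in> M \<Longrightarrow> e = l \<or> e \<in> M \<Longrightarrow> c \<noteq> e \<Longrightarrow> \<bar>S c e\<bar> \<le> d"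
    and c: "c = l \<or> c \<in> M \<and> 2 * real (card N) * d\<^sup>2 < \<bar>S c l\<bar>" and "k \<notin> M"
  shows "\<not> singular N (S(k := (\<lambda>b. of_bool (b = c)))) k l M"
proof
  let ?S = "S(k := (\<lambda>b. of_bool (b = c)))"
  assume "singular N ?S k l M"
  then obtain x where x: "\<exists>a\<in>N. x a \<noteq> 0" "\<And>a. a \<in> N \<Longrightarrow> a \<noteq> l \<Longrightarrow> a \<notin> M \<Longrightarrow> x a = 0"
    "(\<Sum>b\<in>N. ?S k b * x b) = 0" "\<And>a. a \<in> M \<Longrightarrow> (\<Sum>b\<in>N. ?S a b * x b) = 0"
    by (rule singularE) blast
  have M: "(\<Sum>b\<in>N. S a b * x b) = 0" if "a \<in> M" for a
    using x(4)[OF that] that assms(9) by (cases "a = k") auto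
  have approx: "x l \<noteq> 0" "\<And>c. c \<in> M \<Longrightarrow> \<bar>x c / x l + S c l\<bar> \<le> 2 * real (card N) * d\<^sup>2"
    using kernel_approx[where S = S, OF assms(1-5) diag off x(1,2) M] by blast+
  have "(\<Sum>b\<in>N. ?S k b * x b) = (\<Sum>b\<in>N. if b = c then x c else 0)"
    by (rule sum.cong) auto
  then have "x c = 0"
    using x(3) assms(1-3) c by (auto split: if_splits)
  with approx c show False
    by force
qed

section \<open>Matrices with prescribed vanishing minors\<close>

text \<open>In units of \<delta>, \<open>R\<close> bounds the initial entries, while
  \<open>B\<close> must also accommodate an entry solved from a sum, whose size will lie between
  \<open>1 / (4 * R)\<close> and \<open>4 * card N * R^2\<close>. The bound on \<delta> lets a
  higher order in \<delta> outweigh the powers of \<open>B\<close> that arise. Positivity of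
  \<open>f\<close> makes f c * (f a + f b) injective in c.\<close>

locale weights =
  fixes N T :: "'a set" and f :: "'a \<Rightarrow> nat" and R B \<delta> :: real
  assumes finite_N: "finite N" and inj_f: "inj_on f N" and f_pos: "\<And>a. a \<in> N \<Longrightarrow> 0 < f a"
    and R: "1 \<le> R" "\<And>a b. a \<in> N \<Longrightarrow> b \<in> N \<Longrightarrow> 3 ^ (f a * f b) \<le> R"
    and B: "4 * R \<le> B" "4 * real (card N) * R\<^sup>2 \<le> B"
    and \<delta>: "0 < \<delta>" "\<delta> \<in> \<rat>" "8 * B ^ 6 * \<delta> \<le> 1"
begin

abbreviation "n \<equiv> real (card N)"

text \<open>\<open>Z\<close> collects the pairs whose entries have been adjusted. Elsewhere only
  absolute values are prescribed, since the signs depend on \<open>T\<close>.\<close>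

definition regular :: "'a set set \<Rightarrow> ('a \<Rightarrow> 'a \<Rightarrow> real) \<Rightarrow> bool" where
  "regular Z S \<longleftrightarrow> (\<forall>a\<in>N. \<forall>b\<in>N. S a b \<in> \<rat>) \<and> sign_symmetric N T S \<and> (\<forall>a\<in>N. S a a = 1) \<and>
     (\<forall>a\<in>N. \<forall>b\<in>N. a \<noteq> b \<longrightarrow> \<bar>S a b\<bar> \<le> B * \<delta>) \<and>
     (\<forall>a\<in>N. \<forall>b\<in>N. a \<noteq> b \<and> {a, b} \<notin> Z \<longrightarrow> \<bar>S a b\<bar> = \<delta> * 3 ^ (f a * f b))"

lemma regularD:
  assumes "regular Z S"
  shows "\<And>a b. a \<in> N \<Longrightarrow> b \<in> N \<Longrightarrow> S a b \<in> \<rat>" "sign_symmetric N T S"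
    "\<And>a. a \<in> N \<Longrightarrow> S a a = 1" "\<And>a b. a \<in> N \<Longrightarrow> b \<in> N \<Longrightarrow> a \<noteq> b \<Longrightarrow> \<bar>S a b\<bar> \<le> B * \<delta>"
    "\<And>a b. a \<in> N \<Longrightarrow> b \<in> N \<Longrightarrow> a \<noteq> b \<Longrightarrow> {a, b} \<notin> Z \<Longrightarrow> \<bar>S a b\<bar> = \<delta> * 3 ^ (f a * f b)"
  using assms unfolding regular_def by blast+

section \<open>Comparison of orders of magnitude in \<delta>\<close>

lemma card_le_B: "n \<le> B"
proof -
  have "n * 1 \<le> n * R\<^sup>2"
    using R(1) by (intro mult_left_mono) auto
  moreover have "0 \<le> n * R\<^sup>2"
    by simp
  ultimately show ?thesis
    using B(2) by linarith
qed

lemma B_ge_1: "1 \<le> B"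
  using B(1) R(1) by linarith

lemma power_B_\<delta>:
  assumes "k \<le> 6"
  shows "8 * (B ^ k * \<delta>) \<le> 1"
proof -
  have "B ^ k * \<delta> \<le> B ^ 6 * \<delta>"
    using assms B_ge_1 \<delta>(1) by (intro mult_right_mono power_increasing) auto
  then show ?thesis
    using \<delta>(3) by linarith
qed

lemma card_small: "n * (B * \<delta>) \<le> 1/2"
proof -
  have "n * (B * \<delta>) \<le> B * (B * \<delta>)"
    using card_le_B B_ge_1 \<delta>(1) by (intro mult_right_mono) auto
  then show ?thesis
    using power_B_\<delta>[of 2] by (simp add: power2_eq_square)
qed

lemma cubic_error: "2 * n\<^sup>2 * (B * \<delta>) ^ 3 \<le> 2 * B ^ 5 * \<delta> ^ 3"
proof -
  have "n\<^sup>2 \<le> B\<^sup>2"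
    using card_le_B by (intro power_mono) auto
  then have "2 * n\<^sup>2 * (B * \<delta>) ^ 3 \<le> 2 * B\<^sup>2 * (B * \<delta>) ^ 3"
    using B_ge_1 \<delta>(1) by (intro mult_right_mono) auto
  also have "\<dots> = 2 * B ^ 5 * \<delta> ^ 3"
    by (simp add: power_mult_distrib power_add[symmetric])
  finally show ?thesis .
qed

lemma quadratic_error: "n * (B * \<delta>)\<^sup>2 + 2 * n\<^sup>2 * (B * \<delta>) ^ 3 \<le> 2 * B ^ 3 * \<delta>\<^sup>2"
proof -
  have "n * (B * \<delta>)\<^sup>2 \<le> B * (B * \<delta>)\<^sup>2"
    using card_le_B by (intro mult_right_mono) auto
  also have "\<dots> = B ^ 3 * \<delta>\<^sup>2"
    by (simp add: power_mult_distrib power2_eq_square power3_eq_cube)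
  finally have "n * (B * \<delta>)\<^sup>2 \<le> B ^ 3 * \<delta>\<^sup>2" .
  moreover have "2 * B ^ 5 * \<delta> ^ 3 = B ^ 3 * \<delta>\<^sup>2 * (2 * (B\<^sup>2 * \<delta>))"
    by (simp add: power2_eq_square power3_eq_cube numeral_eq_Suc)
  moreover have "B ^ 3 * \<delta>\<^sup>2 * (2 * (B\<^sup>2 * \<delta>)) \<le> B ^ 3 * \<delta>\<^sup>2 * 1"
    using B_ge_1 power_B_\<delta>[of 2] by (intro mult_left_mono) auto
  ultimately show ?thesis
    using cubic_error by linarith
qed

text \<open>The value \<delta> / B separates entries of order \<delta> from anything a vanishing
  minor could equate them with.\<close>

lemma quadratic_less: "2 * B ^ 3 * \<delta>\<^sup>2 < \<delta> / B"
proof -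
  have "2 * B ^ 3 * \<delta>\<^sup>2 * B = \<delta> * (2 * (B ^ 4 * \<delta>))"
    by (simp add: power2_eq_square numeral_eq_Suc)
  also have "\<dots> < \<delta> * 1"
    using power_B_\<delta>[of 4] \<delta>(1) by (intro mult_strict_left_mono) auto
  finally show ?thesis
    using B_ge_1 by (simp add: pos_less_divide_eq)
qed

lemma quadratic_le: "2 * B ^ 3 * \<delta>\<^sup>2 \<le> B * \<delta>"
proof -
  have "\<delta> / B \<le> B * \<delta>"
    using B_ge_1 \<delta>(1) mult_mono[of 1 "B" 1 "B"]
    by (simp add: pos_divide_le_eq)
  then show ?thesis
    using quadratic_less by linarith
qed

text \<open>The left side is the total error in comparing two conditioning sets: two third-order
  expansion errors and at most \<open>card N\<close> negligible products. It must stay below the gap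
  \<delta>^2 of \<open>product_sum_ge\<close>.\<close>

lemma quartic_less: "4 * n\<^sup>2 * (B * \<delta>) ^ 3 + n * (2 * B ^ 4 * \<delta> ^ 3) < \<delta>\<^sup>2"
proof -
  have "n * (2 * B ^ 4 * \<delta> ^ 3) \<le> B * (2 * B ^ 4 * \<delta> ^ 3)"
    using card_le_B B_ge_1 \<delta>(1) by (intro mult_right_mono) auto
  then have "4 * n\<^sup>2 * (B * \<delta>) ^ 3 + n * (2 * B ^ 4 * \<delta> ^ 3) \<le> 6 * B ^ 5 * \<delta> ^ 3"
    using cubic_error by (simp add: numeral_eq_Suc)
  also have "6 * B ^ 5 * \<delta> ^ 3 = \<delta>\<^sup>2 * (6 * (B ^ 5 * \<delta>))"
    by (simp add: power2_eq_square numeral_eq_Suc)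
  also have "\<dots> < \<delta>\<^sup>2 * 1"
    using power_B_\<delta>[of 5] \<delta>(1) by (intro mult_strict_left_mono) auto
  finally show ?thesis by simp
qed

section \<open>Excluding statements by the second-order expansion\<close>

lemma regular_approx:
  assumes "regular Z S" "a \<in> N" "b \<in> N" "C \<subseteq> N - {a, b}" "singular N S a b C"
  shows "\<bar>S a b - (\<Sum>c\<in>C. S a c * S c b)\<bar> \<le> 2 * n\<^sup>2 * (B * \<delta>) ^ 3"
proof (rule singular_approx)
  note S = regularD[OF assms(1)]
  show "S c c = 1" if "c \<in> C" for c
    using that assms(4) S(3) by auto
  show "\<bar>S c e\<bar> \<le> B * \<delta>" if "c \<in> C" "e = b \<or> e \<in> C" "c \<noteq> e" for c e
    using that assms(3,4) by (intro S(4)) auto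
  show "\<bar>S a c\<bar> \<le> B * \<delta>" if "c \<in> C" for c
    using that assms(2,4) by (intro S(4)) auto
qed (use assms finite_N card_small B_ge_1 \<delta>(1) in auto)

lemma product_sum_bound:
  assumes "regular Z S" "a \<in> N" "b \<in> N" "C \<subseteq> N - {a, b}"
  shows "\<bar>\<Sum>c\<in>C. S a c * S c b\<bar> \<le> n * (B * \<delta>)\<^sup>2"
proof -
  note S = regularD[OF assms(1)]
  have "\<bar>\<Sum>c\<in>C. S a c * S c b\<bar> \<le> (\<Sum>c\<in>C. \<bar>S a c\<bar> * \<bar>S c b\<bar>)"
    by (metis (no_types, lifting) abs_mult sum.cong sum_abs)
  also have "\<dots> \<le> (\<Sum>c\<in>C. (B * \<delta>) * (B * \<delta>))"
    using assms B_ge_1 \<delta>(1) by (intro sum_mono mult_mono S(4)) auto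
  also have "\<dots> = real (card C) * ((B * \<delta>) * (B * \<delta>))"
    by simp
  also have "\<dots> \<le> n * ((B * \<delta>) * (B * \<delta>))"
    using assms(4) finite_N by (intro mult_right_mono of_nat_mono card_mono) auto
  finally show ?thesis
    by (simp add: power2_eq_square)
qed

lemma large_entry_nonsingular:
  assumes "regular Z S" "a \<in> N" "b \<in> N" "C \<subseteq> N - {a, b}" "\<delta> / B \<le> \<bar>S a b\<bar>"
  shows "\<not> singular N S a b C"
proof
  assume "singular N S a b C"
  then have "\<bar>S a b - (\<Sum>c\<in>C. S a c * S c b)\<bar> \<le> 2 * n\<^sup>2 * (B * \<delta>) ^ 3"
    using regular_approx assms by blast
  then have "\<bar>S a b\<bar> \<le> 2 * B ^ 3 * \<delta>\<^sup>2"
    using product_sum_bound[OF assms(1-4)] quadratic_error by linarith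
  with assms(5) quadratic_less show False
    by linarith
qed

lemma free_nonsingular:
  assumes "regular Z S" "a \<in> N" "b \<in> N" "a \<noteq> b" "{a, b} \<notin> Z" "C \<subseteq> N - {a, b}"
  shows "\<not> singular N S a b C"
proof (rule large_entry_nonsingular[OF assms(1-3,6)])
  have "\<delta> / B \<le> \<delta> / 1"
    using B_ge_1 \<delta>(1) by (intro divide_left_mono) auto
  also have "\<dots> \<le> \<delta> * 3 ^ (f a * f b)"
    using \<delta>(1) by simp
  finally show "\<delta> / B \<le> \<bar>S a b\<bar>"
    using regularD(5)[OF assms(1-5)] by simp
qed

text \<open>The product through \<open>c\<close> is \<delta>^2 times 3 to the power f c * (f a + f
  b), up to sign, and these exponents are distinct. Leaving the signs of \<open>t\<close> open
  admits differences of two sums.\<close>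

lemma product_sum_ge:
  assumes "regular Z S" "a \<in> N" "b \<in> N" "a \<noteq> b" "D \<subseteq> N - {a, b}" "D \<noteq> {}"
    and "\<And>c. c \<in> D \<Longrightarrow> {a, c} \<notin> Z \<and> {c, b} \<notin> Z"
    and t: "\<And>c. c \<in> D \<Longrightarrow> \<bar>t c\<bar> = \<bar>S a c * S c b\<bar>"
  shows "\<delta>\<^sup>2 \<le> \<bar>\<Sum>c\<in>D. t c\<bar>"
proof -
  note S = regularD[OF assms(1)]
  have "1 \<le> \<bar>\<Sum>c\<in>D. t c / \<delta>\<^sup>2\<bar>"
  proof (rule signed_power_sum_ge_1)
    show "finite D"
      using assms(5) finite_N by (meson finite_Diff finite_subset)
    show "inj_on (\<lambda>c. f c * (f a + f b)) D"
      using assms(2,5) inj_f f_pos[of a] by (auto simp: inj_on_def)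
    show "\<bar>t c / \<delta>\<^sup>2\<bar> = 3 ^ (f c * (f a + f b))" if c: "c \<in> D" for c
    proof -
      have "\<bar>S a c\<bar> = \<delta> * 3 ^ (f a * f c)" "\<bar>S c b\<bar> = \<delta> * 3 ^ (f c * f b)"
        using c assms by (auto intro!: S(5))
      then show ?thesis
        using t[OF c] \<delta>(1)
        by (simp add: abs_mult power2_eq_square power_add distrib_left mult.commute)
    qed
  qed (use assms in auto)
  then show ?thesis
    using \<delta>(1) by (simp add: sum_divide_distrib[symmetric] pos_le_divide_eq)
qed

text \<open>Up to an error of third order, \<open>(ab|M)\<close> and \<open>(ab|C)\<close> equate \<open>S a b\<close> with two sums
  whose difference is a signed sum of distinct powers of 3, scaled by \<open>\<delta>\<^sup>2\<close>.\<close>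

lemma singular_unique:
  assumes "regular Z S" "a \<in> N" "b \<in> N" "a \<noteq> b" "M \<subseteq> N - {a, b}" "C \<subseteq> N - {a, b}"
    and "singular N S a b M" "singular N S a b C"
    and small: "\<And>c. c \<in> sym_diff M C \<Longrightarrow> {a, c} \<in> Z \<or> {c, b} \<in> Z \<Longrightarrow>
      \<bar>S a c * S c b\<bar> \<le> 2 * B ^ 4 * \<delta> ^ 3"
    and c: "c \<in> sym_diff M C"
  shows "{a, c} \<in> Z \<or> {c, b} \<in> Z"
proof (rule ccontr)
  assume contra: "\<not> ({a, c} \<in> Z \<or> {c, b} \<in> Z)"
  \<comment> \<open>Products through indices outside \<open>D\<close> involve an adjusted entry and
    are counted as errors by \<open>small\<close>; the assumed counterexample makes \<open>D\<close>
    nonempty.\<close>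
  define D where "D = {c \<in> sym_diff M C. {a, c} \<notin> Z \<and> {c, b} \<notin> Z}"
  have fin: "finite M" "finite C"
    using assms finite_N by (meson finite_Diff finite_subset)+
  define p where "p c = S a c * S c b" for c
  define t where "t c = (if c \<in> M then p c else - p c)" for c
  have D: "D \<subseteq> sym_diff M C" "finite D" "finite (sym_diff M C)"
    using fin by (auto simp: D_def)
  have "(\<Sum>c\<in>M. p c) - (\<Sum>c\<in>C. p c) = (\<Sum>c\<in>M - C. p c) - (\<Sum>c\<in>C - M. p c)"
    using fin sum.Int_Diff[of M p C] sum.Int_Diff[of C p M] by (simp add: Int_commute)
  also have "\<dots> = (\<Sum>c\<in>sym_diff M C. t c)"
    using fin by (subst sum.union_disjoint) (auto simp: t_def sum_negf)
  also have "\<dots> = (\<Sum>c\<in>D. t c) + (\<Sum>c\<in>sym_diff M C - D. t c)"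
    using D sum.subset_diff[of D "sym_diff M C" t] by simp
  finally have split: "(\<Sum>c\<in>M. p c) - (\<Sum>c\<in>C. p c) = \<dots>" .
  have "\<bar>\<Sum>c\<in>sym_diff M C - D. t c\<bar> \<le> (\<Sum>c\<in>sym_diff M C - D. \<bar>t c\<bar>)"
    by (rule sum_abs)
  also have "\<dots> \<le> (\<Sum>c\<in>sym_diff M C - D. 2 * B ^ 4 * \<delta> ^ 3)"
    using small by (intro sum_mono) (auto simp: D_def t_def p_def)
  also have "\<dots> = real (card (sym_diff M C - D)) * (2 * B ^ 4 * \<delta> ^ 3)"
    by simp
  also have "\<dots> \<le> n * (2 * B ^ 4 * \<delta> ^ 3)"
    using assms(5,6) finite_N B_ge_1 \<delta>(1) by (intro mult_right_mono of_nat_mono card_mono) auto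
  finally have rest: "\<bar>\<Sum>c\<in>sym_diff M C - D. t c\<bar> \<le> n * (2 * B ^ 4 * \<delta> ^ 3)" .
  have "\<delta>\<^sup>2 \<le> \<bar>\<Sum>c\<in>D. t c\<bar>"
  proof (rule product_sum_ge[OF assms(1-4)])
    show "D \<subseteq> N - {a, b}"
      using assms(5,6) by (auto simp: D_def)
    show "D \<noteq> {}"
      using c contra by (auto simp: D_def)
  qed (auto simp: D_def t_def p_def)
  moreover have "\<bar>S a b - (\<Sum>c\<in>M. p c)\<bar> \<le> 2 * n\<^sup>2 * (B * \<delta>) ^ 3"
    "\<bar>S a b - (\<Sum>c\<in>C. p c)\<bar> \<le> 2 * n\<^sup>2 * (B * \<delta>) ^ 3"
    using regular_approx assms unfolding p_def by blast+
  ultimately show False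
    using split rest quartic_less by linarith
qed

lemma singular_empty_iff:
  assumes "a \<in> N" "b \<in> N" "a \<noteq> b"
  shows "singular N S a b {} \<longleftrightarrow> S a b = 0"
proof
  assume "singular N S a b {}"
  then obtain x where x: "\<exists>c\<in>N. x c \<noteq> 0" "\<And>c. c \<in> N \<Longrightarrow> c \<noteq> b \<Longrightarrow> x c = 0"
    "(\<Sum>c\<in>N. S a c * x c) = 0"
    by (rule singularE) auto
  have "(\<Sum>c\<in>N. S a c * x c) = (\<Sum>c\<in>N. if c = b then S a b * x b else 0)"
    using x(2) by (intro sum.cong) auto
  then have "S a b * x b = 0"
    using x(3) assms finite_N by simp
  moreover have "x b \<noteq> 0"
    using x(1,2) by blast
  ultimately show "S a b = 0"
    by simp
next
  assume S: "S a b = 0"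
  show "singular N S a b {}"
  proof (rule singularI)
    show "\<exists>c\<in>N. of_bool (c = b) \<noteq> (0 :: real)"
      using assms by auto
    show "(\<Sum>c\<in>N. S a' c * of_bool (c = b)) = 0" if "a' = a \<or> a' \<in> {}" for a'
      using that S by (intro sum.neutral) auto
  qed auto
qed

section \<open>The initial matrix and the adjustment of its entries\<close>

definition weight :: "'a \<Rightarrow> 'a \<Rightarrow> real" where
  "weight a b = (if a = b then 1 else if a \<in> T \<and> b \<notin> T then - (\<delta> * 3 ^ (f a * f b))
     else \<delta> * 3 ^ (f a * f b))"

definition set_pair :: "'a \<Rightarrow> 'a \<Rightarrow> real \<Rightarrow> ('a \<Rightarrow> 'a \<Rightarrow> real) \<Rightarrow> 'a \<Rightarrow> 'a \<Rightarrow> real" where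
  "set_pair i j z S a b = (if a = i \<and> b = j then z
     else if a = j \<and> b = i then (if i \<in> T \<longleftrightarrow> j \<in> T then z else - z) else S a b)"

lemma entry_le: "a \<in> N \<Longrightarrow> b \<in> N \<Longrightarrow> \<delta> * 3 ^ (f a * f b) \<le> R * \<delta>"
  using R(2)[of a b] \<delta>(1) by (simp add: mult.commute)

lemma R_le_B: "R * \<delta> \<le> B * \<delta>"
  using R(1) B(1) \<delta>(1) by (intro mult_right_mono) auto

lemma regular_weight: "regular {} weight"
proof -
  have "\<bar>weight a b\<bar> \<le> B * \<delta>" if "a \<in> N" "b \<in> N" "a \<noteq> b" for a b
    using entry_le[OF that(1,2)] R_le_B that(3) \<delta>(1) by (auto simp: weight_def)
  then show ?thesis
    using \<delta>(1,2) by (auto simp: regular_def weight_def sign_symmetric_def mult.commute)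
qed

lemma regular_set_pair:
  assumes "regular Z S" "i \<in> N" "j \<in> N" "i \<noteq> j" "z \<in> \<rat>" "\<bar>z\<bar> \<le> B * \<delta>"
  shows "regular (insert {i, j} Z) (set_pair i j z S)"
proof -
  note S = regularD[OF assms(1)]
  have "sign_symmetric N T (set_pair i j z S)"
    unfolding sign_symmetric_def
  proof (intro ballI)
    fix a b assume "a \<in> N" "b \<in> N"
    then have "S b a = (if a \<in> T \<longleftrightarrow> b \<in> T then S a b else - S a b)"
      using S(2) unfolding sign_symmetric_def by blast
    then show "set_pair i j z S b a =
        (if a \<in> T \<longleftrightarrow> b \<in> T then set_pair i j z S a b else - set_pair i j z S a b)"
      using assms(4) by (simp add: set_pair_def)
  qed
  moreover have "\<bar>set_pair i j z S a b\<bar> = \<delta> * 3 ^ (f a * f b)"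
    if "a \<in> N" "b \<in> N" "a \<noteq> b" "{a, b} \<notin> insert {i, j} Z" for a b
  proof -
    have "\<not> (a = i \<and> b = j)" "\<not> (a = j \<and> b = i)"
      using that(4) by auto
    then have "set_pair i j z S a b = S a b"
      unfolding set_pair_def by argo
    then show ?thesis
      using S(5)[OF that(1-3)] that(4) by simp
  qed
  moreover have "set_pair i j z S a b \<in> \<rat>" "a \<noteq> b \<Longrightarrow> \<bar>set_pair i j z S a b\<bar> \<le> B * \<delta>"
    if "a \<in> N" "b \<in> N" for a b
    using S(1)[OF that] S(4)[OF that] assms(5,6) by (simp_all add: set_pair_def)
  moreover have "set_pair i j z S a a = 1" if "a \<in> N" for a
    using S(3)[OF that] assms(4) by (auto simp: set_pair_def)
  ultimately show ?thesis
    unfolding regular_def by (intro conjI ballI impI) auto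
qed

text \<open>Pairs outside \<open>Z\<close> carry entries too large to satisfy any statement. A pair
  in \<open>Z\<close> needs checking in one orientation only, by
  \<open>singular_sym\<close>.\<close>

lemma regular_realizes:
  assumes "regular Z S" "B * \<delta> < d" "\<And>p K. (p, K) \<in> G \<Longrightarrow> p \<in> Z"
    and Z: "\<And>p. p \<in> Z \<Longrightarrow> \<exists>i\<in>N. \<exists>j\<in>N. i \<noteq> j \<and> p = {i, j} \<and>
      (\<forall>K. K \<subseteq> N - {i, j} \<longrightarrow> (singular N S i j K \<longleftrightarrow> ci i j K \<in> G))"
  shows "realizes N T G d S"
proof -
  note S = regularD[OF assms(1)]
  have "singular N S a b K \<longleftrightarrow> ci a b K \<in> G"
    if ab: "a \<in> N" "b \<in> N" "a \<noteq> b" "K \<subseteq> N - {a, b}" for a b K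
  proof (cases "{a, b} \<in> Z")
    case False
    then show ?thesis
      using free_nonsingular[OF assms(1) ab(1-3) False ab(4)] assms(3) by blast
  next
    case True
    then obtain i j where ij: "i \<in> N" "j \<in> N" "i \<noteq> j" "{a, b} = {i, j}"
      "\<And>K. K \<subseteq> N - {i, j} \<Longrightarrow> singular N S i j K \<longleftrightarrow> ci i j K \<in> G"
      using Z by meson
    have "singular N S a b K \<longleftrightarrow> singular N S i j K"
      using ij(4) singular_sym[OF finite_N S(2) ab] ab
        singular_sym[OF finite_N S(2) ab(2,1)]
      by (auto simp: doubleton_eq_iff insert_commute)
    then show ?thesis
      using ij ab(4) by simp
  qed
  moreover have "\<bar>S a b - of_bool (a = b)\<bar> < d" if "a \<in> N" "b \<in> N" for a b
  proof (cases "a = b")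
    case True
    have "0 < B * \<delta>"
      using B_ge_1 \<delta>(1) by simp
    with True that S(3) assms(2) show ?thesis
      by simp
  next
    case False
    with that S(4)[of a b] assms(2) show ?thesis
      by simp
  qed
  ultimately show ?thesis
    unfolding realizes_def using S(1,2) by blast
qed

end

text \<open>An exact criterion for the cases that the expansion cannot decide because the product
  through \<open>c\<close> is zero or of third order.\<close>

lemma singular_singleton_iff:
  assumes "finite N" "a \<in> N" "b \<in> N" "c \<in> N" "b \<noteq> c" "S c c = 1"
  shows "singular N S a b {c} \<longleftrightarrow> S a b = S a c * S c b"
proof
  assume "singular N S a b {c}"
  then obtain x where x: "\<exists>e\<in>N. x e \<noteq> 0" "\<And>e. e \<in> N \<Longrightarrow> e \<noteq> b \<Longrightarrow> e \<noteq> c \<Longrightarrow> x e = 0"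
    "(\<Sum>e\<in>N. S a e * x e) = 0" "(\<Sum>e\<in>N. S c e * x e) = 0"
    by (rule singularE) auto
  have sum: "(\<Sum>e\<in>N. S p e * x e) = S p b * x b + S p c * x c" for p
  proof -
    have "(\<Sum>e\<in>N. S p e * x e) = (\<Sum>e\<in>{b, c}. S p e * x e)"
      using assms(1-4) x(2) by (intro sum.mono_neutral_right) auto
    then show ?thesis
      using assms(5) by simp
  qed
  have xc: "x c = - (S c b * x b)"
    using x(4)[unfolded sum] assms(6) by simp
  then have "x b \<noteq> 0"
    using x(1,2) by (metis mult_zero_right neg_0_equal_iff_equal)
  moreover have "(S a b - S a c * S c b) * x b = 0"
    using x(3)[unfolded sum] xc by (simp add: algebra_simps)
  ultimately show "S a b = S a c * S c b"
    by simp
next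
  assume eq: "S a b = S a c * S c b"
  define x where "x e = (if e = b then 1 else if e = c then - S c b else 0)" for e
  have sum: "(\<Sum>e\<in>N. S p e * x e) = S p b - S p c * S c b" for p
  proof -
    have "(\<Sum>e\<in>N. S p e * x e) = (\<Sum>e\<in>{b, c}. S p e * x e)"
      using assms(1-4) by (intro sum.mono_neutral_right) (auto simp: x_def)
    then show ?thesis
      using assms(5) by (simp add: x_def)
  qed
  show "singular N S a b {c}"
  proof (rule singularI)
    show "\<exists>e\<in>N. x e \<noteq> 0"
      using assms(3) by (auto simp: x_def)
    show "(\<Sum>e\<in>N. S p e * x e) = 0" if "p = a \<or> p \<in> {c}" for p
      using that eq assms(6) unfolding sum by auto
  qed (auto simp: x_def)
qed

text \<open>A kernel vector for \<open>(im|D)\<close> and one for \<open>(im|jD)\<close> are proportional, which gives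
  \<open>(jm|D)\<close>, or some combination of them without \<open>m\<close>-coordinate gives \<open>(ij|D)\<close>.\<close>

lemma singular_weak_transitivity:
  assumes "finite N" "singular N S i m D" "singular N S i m (insert j D)" "j \<in> N" "m \<in> N"
    and D: "\<And>x. \<exists>a\<in>N. x a \<noteq> 0 \<Longrightarrow> (\<And>a. a \<in> N \<Longrightarrow> a \<noteq> m \<Longrightarrow> a \<notin> D \<Longrightarrow> x a = 0) \<Longrightarrow>
      (\<And>a. a \<in> D \<Longrightarrow> (\<Sum>b\<in>N. S a b * x b) = 0) \<Longrightarrow> x m \<noteq> 0"
  shows "singular N S i j D \<or> singular N S j m D"
proof -
  obtain y where y: "\<exists>a\<in>N. y a \<noteq> 0" "\<And>a. a \<in> N \<Longrightarrow> a \<noteq> m \<Longrightarrow> a \<notin> D \<Longrightarrow> y a = 0"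
    "(\<Sum>b\<in>N. S i b * y b) = 0" "\<And>a. a \<in> D \<Longrightarrow> (\<Sum>b\<in>N. S a b * y b) = 0"
    using assms(2) by (rule singularE) blast
  obtain z where z: "\<exists>a\<in>N. z a \<noteq> 0" "\<And>a. a \<in> N \<Longrightarrow> a \<noteq> m \<Longrightarrow> a \<notin> insert j D \<Longrightarrow> z a = 0"
    "(\<Sum>b\<in>N. S i b * z b) = 0" "\<And>a. a \<in> insert j D \<Longrightarrow> (\<Sum>b\<in>N. S a b * z b) = 0"
    using assms(3) by (rule singularE) blast
  have ym: "y m \<noteq> 0"
    using D y(1,2,4) by blast
  define w where "w a = y m * z a - z m * y a" for a
  have sum: "(\<Sum>b\<in>N. S a b * w b) = y m * (\<Sum>b\<in>N. S a b * z b) - z m * (\<Sum>b\<in>N. S a b * y b)" for a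
    by (simp add: w_def sum_distrib_left sum_subtractf algebra_simps)
  show ?thesis
  proof (cases "\<exists>a\<in>N. w a \<noteq> 0")
    case True
    have "singular N S i j D"
    proof (rule singularI[OF True])
      show "w a = 0" if "a \<in> N" "a \<noteq> j" "a \<notin> D" for a
        using that y(2) z(2) by (cases "a = m") (auto simp: w_def)
      show "(\<Sum>b\<in>N. S a b * w b) = 0" if "a = i \<or> a \<in> D" for a
        using that y(3,4) z(3,4) unfolding sum by auto
    qed
    then show ?thesis ..
  next
    case False
    have zm: "z m \<noteq> 0"
    proof
      assume "z m = 0"
      then have "z a = 0" if "a \<in> N" for a
        using False that ym by (simp add: w_def)
      with z(1) show False by blast
    qed
    have "singular N S j m D"
    proof (rule singularI[OF y(1)])
      have "(\<Sum>b\<in>N. S j b * w b) = 0"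
        using False by (intro sum.neutral) auto
      then have "(\<Sum>b\<in>N. S j b * y b) = 0"
        using sum[of j] z(4)[of j] zm by simp
      then show "(\<Sum>b\<in>N. S a b * y b) = 0" if "a = j \<or> a \<in> D" for a
        using that y(4) by blast
    qed (use y(2) in blast)
    then show ?thesis ..
  qed
qed

context weights
begin

section \<open>Realizations of the structures containing an unconditional statement, and of the
  empty one\<close>

lemma realizes_empty:
  assumes "B * \<delta> < d"
  shows "\<exists>S. realizes N T {} d S"
proof
  show "realizes N T {} d weight"
    by (rule regular_realizes[OF regular_weight assms]) auto
qed

lemma regular_realizes_pairs:
  assumes "regular {{k, l}, {i, j}} S" "B * \<delta> < d"
    and N: "i \<in> N" "j \<in> N" "i \<noteq> j" "k \<in> N" "l \<in> N" "k \<noteq> l"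
    and G: "\<And>p K. (p, K) \<in> G \<Longrightarrow> p = {i, j} \<or> p = {k, l}"
    and ij: "\<And>K. K \<subseteq> N - {i, j} \<Longrightarrow> singular N S i j K \<longleftrightarrow> ci i j K \<in> G"
    and kl: "\<And>K. K \<subseteq> N - {k, l} \<Longrightarrow> singular N S k l K \<longleftrightarrow> ci k l K \<in> G"
  shows "\<exists>S. realizes N T G d S"
proof
  show "realizes N T G d S"
  proof (rule regular_realizes[OF assms(1,2)])
    show "p \<in> {{k, l}, {i, j}}" if "(p, K) \<in> G" for p K
      using G[OF that] by blast
    fix p assume "p \<in> {{k, l}, {i, j}}"
    then consider "p = {k, l}" | "p = {i, j}" by blast
    then show "\<exists>i\<in>N. \<exists>j\<in>N. i \<noteq> j \<and> p = {i, j} \<and>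
      (\<forall>K. K \<subseteq> N - {i, j} \<longrightarrow> (singular N S i j K \<longleftrightarrow> ci i j K \<in> G))"
    proof cases
      case 1
      with N kl show ?thesis by (intro bexI[of _ k] bexI[of _ l]) simp_all
    next
      case 2
      with N ij show ?thesis by (intro bexI[of _ i] bexI[of _ j]) simp_all
    qed
  qed
qed

lemma regular_zero:
  assumes "regular Z S" "i \<in> N" "j \<in> N" "i \<noteq> j"
  shows "regular (insert {i, j} Z) (set_pair i j 0 S)"
  using assms B_ge_1 \<delta>(1) by (intro regular_set_pair) auto

lemma realizes_singleton:
  assumes "B * \<delta> < d" "i \<in> N" "j \<in> N" "i \<noteq> j"
  shows "\<exists>S. realizes N T {ci i j {}} d S"
proof -
  let ?S = "set_pair i j 0 weight"
  have reg: "regular {{i, j}} ?S"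
    using regular_zero[OF regular_weight] assms by simp
  have empty: "singular N ?S i j {}"
    using assms by (simp add: singular_empty_iff set_pair_def)
  have "singular N ?S i j K \<longleftrightarrow> K = {}" if K: "K \<subseteq> N - {i, j}" for K
  proof
    assume sing: "singular N ?S i j K"
    \<comment> \<open>No conditioning index meets the adjusted pair, so nothing has to be shown
      about small products and \<open>singular_unique\<close> leaves only the empty set.\<close>
    have no: "{i, c} \<notin> {{i, j}}" "{c, j} \<notin> {{i, j}}" if "c \<in> K" for c
      using that K by (auto simp: doubleton_eq_iff)
    have "{i, c} \<in> {{i, j}} \<or> {c, j} \<in> {{i, j}}" if "c \<in> K" for c
    proof (rule singular_unique[OF reg assms(2-4) _ K empty sing])
      show "c \<in> sym_diff {} K" using that by simp
      show "\<bar>?S i c' * ?S c' j\<bar> \<le> 2 * B ^ 4 * \<delta> ^ 3"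
        if "c' \<in> sym_diff {} K" "{i, c'} \<in> {{i, j}} \<or> {c', j} \<in> {{i, j}}" for c'
        using that no[of c'] by blast
    qed simp
    with no show "K = {}" by blast
  qed (simp add: empty)
  then show ?thesis
    using assms reg by (intro regular_realizes_pairs[of i j i j ?S]) auto
qed

text \<open>The product through \<open>k\<close> is 0, so the expansion determines \<open>K\<close>
  only up to \<open>k\<close>; both remaining sets do satisfy the statement exactly.\<close>

lemma singular_two_zeros:
  assumes reg: "regular Z S" "Z = {{i, j}, {i, k}}" and S: "S i j = 0" "S i k = 0"
    and N: "i \<in> N" "j \<in> N" "k \<in> N" "i \<noteq> j" "i \<noteq> k" "j \<noteq> k" and K: "K \<subseteq> N - {i, j}"
  shows "singular N S i j K \<longleftrightarrow> K = {} \<or> K = {k}"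
proof
  have empty: "singular N S i j {}"
    using S N by (simp add: singular_empty_iff)
  have only: "c = k" if "c \<in> K" "{i, c} \<in> Z \<or> {c, j} \<in> Z" for c
    using that K N unfolding reg(2) by (auto simp: doubleton_eq_iff)
  assume sing: "singular N S i j K"
  have "{i, c} \<in> Z \<or> {c, j} \<in> Z" if "c \<in> K" for c
  proof (rule singular_unique[OF reg(1) N(1,2,4) _ K empty sing])
    show "c \<in> sym_diff {} K" using that by simp
    show "\<bar>S i c' * S c' j\<bar> \<le> 2 * B ^ 4 * \<delta> ^ 3"
      if "c' \<in> sym_diff {} K" "{i, c'} \<in> Z \<or> {c', j} \<in> Z" for c'
      using that only[of c'] S B_ge_1 \<delta>(1) by auto
  qed simp
  with only have "K \<subseteq> {k}" by blast
  then show "K = {} \<or> K = {k}"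
    by (rule subset_singletonD)
next
  assume "K = {} \<or> K = {k}"
  then show "singular N S i j K"
    using S N regularD(3)[OF reg(1)] finite_N
    by (auto simp: singular_empty_iff singular_singleton_iff)
qed

lemma realizes_square:
  assumes "B * \<delta> < d" and N: "i \<in> N" "j \<in> N" "k \<in> N" "i \<noteq> j" "i \<noteq> k" "j \<noteq> k"
  shows "\<exists>S. realizes N T {ci i j {}, ci i k {}, ci i j {k}, ci i k {j}} d S"
proof -
  let ?S = "set_pair i j 0 (set_pair i k 0 weight)"
  have reg: "regular {{i, j}, {i, k}} ?S"
    using regular_zero[OF regular_zero[OF regular_weight]] N by simp
  have S: "?S i j = 0" "?S i k = 0"
    using N by (auto simp: set_pair_def)
  have "singular N ?S i j K \<longleftrightarrow> K = {} \<or> K = {k}" if "K \<subseteq> N - {i, j}" for K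
    using singular_two_zeros[OF reg refl S N that] .
  moreover have "singular N ?S i k K \<longleftrightarrow> K = {} \<or> K = {j}" if "K \<subseteq> N - {i, k}" for K
    using that N S by (intro singular_two_zeros[OF reg]) (auto simp: insert_commute)
  ultimately show ?thesis
    using N by (intro regular_realizes_pairs[OF reg assms(1)]) (auto simp: doubleton_eq_iff)
qed

text \<open>Solving \<open>(kl|M)\<close> for the entry of its own pair makes this entry a sum of
  products of off-diagonal entries, up to third order; hence it is of second order.\<close>

lemma solve_pair:
  assumes reg: "regular Z S" and N: "k \<in> N" "l \<in> N" "k \<noteq> l" "M \<subseteq> N - {k, l}"
  obtains z where "\<bar>z\<bar> \<le> 2 * B ^ 3 * \<delta>\<^sup>2" "regular (insert {k, l} Z) (set_pair k l z S)"
    "singular N (set_pair k l z S) k l M"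
proof -
  note S = regularD[OF reg]
  have M: "M \<subseteq> N - {l}" "k \<notin> M"
    using N by auto
  have d: "0 \<le> B * \<delta>"
    using B_ge_1 \<delta>(1) by simp
  have diag: "S c c = 1" if "c \<in> M" for c
    using that N S(3) by auto
  have off: "\<bar>S c e\<bar> \<le> B * \<delta>" if "c \<in> M" "e = l \<or> e \<in> M" "c \<noteq> e" for c e
    using that N by (intro S(4)) auto
  have "\<not> singular N (S(k := (\<lambda>b. of_bool (b = l)))) k l M"
    using nonsingular_unit_row[where S = S and c = l, OF finite_N N(2) M(1) d card_small diag off]
      M(2) by blast
  then obtain z where z: "z \<in> \<rat>" "singular N (S(k := (S k)(l := z))) k l M"
    using singular_solve_entry[OF finite_N N, of l S] S(1) by blast
  let ?S = "S(k := (S k)(l := z))"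
  have "\<bar>?S k l - (\<Sum>c\<in>M. ?S k c * ?S c l)\<bar> \<le> 2 * n\<^sup>2 * (B * \<delta>) ^ 3"
  proof (rule singular_approx[OF finite_N N(2) M(1) d card_small _ _ _ z(2)])
    show "?S c c = 1" if "c \<in> M" for c
      using that M(2) diag by auto
    show "\<bar>?S c e\<bar> \<le> B * \<delta>" if "c \<in> M" "e = l \<or> e \<in> M" "c \<noteq> e" for c e
      using that M(2) off by auto
    show "\<bar>?S k c\<bar> \<le> B * \<delta>" if "c \<in> M" for c
      using that N S(4)[of k c] M by auto
  qed
  moreover have "(\<Sum>c\<in>M. ?S k c * ?S c l) = (\<Sum>c\<in>M. S k c * S c l)"
    using N by (intro sum.cong) auto
  ultimately have "\<bar>z - (\<Sum>c\<in>M. S k c * S c l)\<bar> \<le> 2 * n\<^sup>2 * (B * \<delta>) ^ 3"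
    by simp
  then have bound: "\<bar>z\<bar> \<le> 2 * B ^ 3 * \<delta>\<^sup>2"
    using product_sum_bound[OF reg N(1,2,4)] quadratic_error by linarith
  \<comment> \<open>The mirrored entry in row \<open>l\<close> and column \<open>k\<close> lies
    outside the submatrix with rows kM and columns lM.\<close>
  have "singular N (set_pair k l z S) k l M \<longleftrightarrow> singular N ?S k l M"
    using N by (intro singular_cong) (auto simp: set_pair_def)
  moreover have "regular (insert {k, l} Z) (set_pair k l z S)"
    using reg N z(1) bound quadratic_le by (intro regular_set_pair) auto
  ultimately show thesis
    using that bound z(2) by blast
qed

text \<open>As the pairs are disjoint, the products relevant to either of them avoid both adjusted
  entries, so \<open>singular_unique\<close> determines both conditioning sets completely.\<close>

lemma realizes_disjoint:
  assumes "B * \<delta> < d" and N: "i \<in> N" "j \<in> N" "i \<noteq> j" "k \<in> N" "l \<in> N" "k \<noteq> l"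
    and disj: "{i, j} \<inter> {k, l} = {}" and M: "M \<subseteq> N - {k, l}"
  shows "\<exists>S. realizes N T {ci i j {}, ci k l M} d S"
proof -
  have "regular {{i, j}} (set_pair i j 0 weight)"
    using regular_zero[OF regular_weight] N by simp
  then obtain z where z: "regular {{k, l}, {i, j}} (set_pair k l z (set_pair i j 0 weight))"
    "singular N (set_pair k l z (set_pair i j 0 weight)) k l M"
    using solve_pair[OF _ N(4-6) M] by blast
  define S where "S = set_pair k l z (set_pair i j 0 weight)"
  define Z where "Z = {{k, l}, {i, j}}"
  have reg: "regular Z S" and kl: "singular N S k l M"
    using z by (simp_all add: S_def Z_def)
  have "S i j = 0"
    using disj by (auto simp: S_def set_pair_def)
  then have ij: "singular N S i j {}"
    using N by (simp add: singular_empty_iff)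
  have no: "{i, c} \<notin> Z" "{c, j} \<notin> Z" if "c \<notin> {i, j}" for c
    using that disj by (auto simp: Z_def doubleton_eq_iff)
  have no': "{k, c} \<notin> Z" "{c, l} \<notin> Z" if "c \<notin> {k, l}" for c
    using that disj by (auto simp: Z_def doubleton_eq_iff)
  have "singular N S i j K \<longleftrightarrow> K = {}" if K: "K \<subseteq> N - {i, j}" for K
  proof
    assume sing: "singular N S i j K"
    have "False" if c: "c \<in> K" for c
    proof -
      have "{i, c} \<in> Z \<or> {c, j} \<in> Z"
      proof (rule singular_unique[OF reg N(1-3) _ K ij sing])
        show "\<bar>S i c' * S c' j\<bar> \<le> 2 * B ^ 4 * \<delta> ^ 3"
          if "c' \<in> sym_diff {} K" "{i, c'} \<in> Z \<or> {c', j} \<in> Z" for c'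
          using that no[of c'] K by blast
      qed (use c in auto)
      with no[of c] c K show False by blast
    qed
    then show "K = {}" by blast
  qed (simp add: ij)
  moreover have "singular N S k l K \<longleftrightarrow> K = M" if K: "K \<subseteq> N - {k, l}" for K
  proof
    assume sing: "singular N S k l K"
    have "False" if c: "c \<in> sym_diff M K" for c
    proof -
      have "{k, c} \<in> Z \<or> {c, l} \<in> Z"
      proof (rule singular_unique[OF reg N(4-6) M K kl sing _ c])
        show "\<bar>S k c' * S c' l\<bar> \<le> 2 * B ^ 4 * \<delta> ^ 3"
          if "c' \<in> sym_diff M K" "{k, c'} \<in> Z \<or> {c', l} \<in> Z" for c'
          using that no'[of c'] K M by blast
      qed
      with no'[of c] c K M show False by blast
    qed
    then show "K = M" by blast
  qed (simp add: kl)
  moreover have "{i, j} \<noteq> {k, l}"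
    using disj by auto
  ultimately show ?thesis
    using N by (intro regular_realizes_pairs[OF reg[unfolded Z_def] assms(1)]) auto
qed

text \<open>A second-order entry times a first-order entry is negligible in the sense required by
  \<open>singular_unique\<close>.\<close>

lemma small_product:
  assumes "\<bar>u\<bar> \<le> 2 * B ^ 3 * \<delta>\<^sup>2" "\<bar>v\<bar> \<le> B * \<delta>"
  shows "\<bar>u * v\<bar> \<le> 2 * B ^ 4 * \<delta> ^ 3"
proof -
  have "\<bar>u * v\<bar> \<le> (2 * B ^ 3 * \<delta>\<^sup>2) * (B * \<delta>)"
    unfolding abs_mult using assms B_ge_1 \<delta>(1) by (intro mult_mono) auto
  also have "\<dots> = 2 * B ^ 4 * \<delta> ^ 3"
    by (simp add: power2_eq_square numeral_eq_Suc)
  finally show ?thesis .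
qed

text \<open>The matrix counterpart of gaussoid axiom (iii).\<close>

lemma regular_weak_transitivity:
  assumes "regular Z S" "i \<in> N" "j \<in> N" "m \<in> N" "D \<subseteq> N - {i, j, m}"
    and "singular N S i m D" "singular N S i m (insert j D)"
  shows "singular N S i j D \<or> singular N S j m D"
proof (rule singular_weak_transitivity[OF finite_N assms(6,7,3,4)])
  note S = regularD[OF assms(1)]
  fix x assume x: "\<exists>a\<in>N. x a \<noteq> 0" "\<And>a. a \<in> N \<Longrightarrow> a \<noteq> m \<Longrightarrow> a \<notin> D \<Longrightarrow> x a = 0"
    "\<And>a. a \<in> D \<Longrightarrow> (\<Sum>b\<in>N. S a b * x b) = 0"
  have D: "D \<subseteq> N - {m}"
    using assms(5) by auto
  have d: "0 \<le> B * \<delta>"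
    using B_ge_1 \<delta>(1) by simp
  have diag: "S c c = 1" if "c \<in> D" for c
    using that assms(5) S(3) by auto
  have off: "\<bar>S c e\<bar> \<le> B * \<delta>" if "c \<in> D" "e = m \<or> e \<in> D" "c \<noteq> e" for c e
    using that assms(4,5) by (intro S(4)) auto
  show "x m \<noteq> 0"
    using kernel_approx(1)[where S = S, OF finite_N assms(4) D d card_small diag off x] by blast
qed

text \<open>Each adjusted entry hides one index from the other pair: for ij the product through
  \<open>m\<close> is of third order, and for im the product through \<open>j\<close> is 0. The
  expansion thus leaves K = {m} open for ij and a difference by \<open>j\<close> from
  \<open>M\<close> for im. Both are refuted using an element of \<open>M\<close> other than
  \<open>j\<close>.\<close>

lemma realizes_adjacent:
  assumes "B * \<delta> < d" and N: "i \<in> N" "j \<in> N" "i \<noteq> j" "m \<in> N" "i \<noteq> m" "j \<noteq> m"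
    and M: "M \<subseteq> N - {i, m}" "M - {j} \<noteq> {}"
  shows "\<exists>S. realizes N T {ci i j {}, ci i m M} d S"
proof -
  have "regular {{i, j}} (set_pair i j 0 weight)"
    using regular_zero[OF regular_weight] N by simp
  then obtain z where z: "\<bar>z\<bar> \<le> 2 * B ^ 3 * \<delta>\<^sup>2"
    "regular {{i, m}, {i, j}} (set_pair i m z (set_pair i j 0 weight))"
    "singular N (set_pair i m z (set_pair i j 0 weight)) i m M"
    using solve_pair[OF _ N(1,4,5) M(1)] by blast
  define S where "S = set_pair i m z (set_pair i j 0 weight)"
  define Z where "Z = {{i, m}, {i, j}}"
  have reg: "regular Z S" and im: "singular N S i m M"
    using z by (simp_all add: S_def Z_def)
  note S = regularD[OF reg]
  have Sij: "S i j = 0" and Sim: "\<bar>S i m\<bar> \<le> 2 * B ^ 3 * \<delta>\<^sup>2"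
    using N z(1) by (auto simp: S_def set_pair_def)
  have small: "0 \<le> 2 * B ^ 4 * \<delta> ^ 3"
    using B_ge_1 \<delta>(1) by simp
  have ij: "singular N S i j {}"
    using Sij N by (simp add: singular_empty_iff)
  have only: "c = m" if "{i, c} \<in> Z \<or> {c, j} \<in> Z" "c \<notin> {i, j}" for c
    using that N by (auto simp: Z_def doubleton_eq_iff)
  have only': "c = j" if "{i, c} \<in> Z \<or> {c, m} \<in> Z" "c \<notin> {i, m}" for c
    using that N by (auto simp: Z_def doubleton_eq_iff)
  have jm: "{j, m} \<notin> Z"
    using N by (auto simp: Z_def doubleton_eq_iff)
  have unique: "c = j"
    if sing: "singular N S i m C" "singular N S i m C'" and C: "C \<subseteq> N - {i, m}" "C' \<subseteq> N - {i, m}"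
      and c: "c \<in> sym_diff C C'" for C C' c
  proof (rule only')
    show "{i, c} \<in> Z \<or> {c, m} \<in> Z"
    proof (rule singular_unique[OF reg N(1,4,5) C sing _ c])
      show "\<bar>S i c' * S c' m\<bar> \<le> 2 * B ^ 4 * \<delta> ^ 3"
        if "c' \<in> sym_diff C C'" "{i, c'} \<in> Z \<or> {c', m} \<in> Z" for c'
      proof -
        have "c' = j"
          using that C by (intro only') auto
        then show ?thesis
          using Sij small by simp
      qed
    qed
    show "c \<notin> {i, m}"
      using c C by auto
  qed
  have ij_only: "K \<subseteq> {m}" if K: "K \<subseteq> N - {i, j}" and sing: "singular N S i j K" for K
  proof
    fix c assume c: "c \<in> K"
    have "{i, c} \<in> Z \<or> {c, j} \<in> Z"
    proof (rule singular_unique[OF reg N(1-3) _ K ij sing])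
      show "\<bar>S i c' * S c' j\<bar> \<le> 2 * B ^ 4 * \<delta> ^ 3"
        if "c' \<in> sym_diff {} K" "{i, c'} \<in> Z \<or> {c', j} \<in> Z" for c'
      proof -
        have "c' = m"
          using that K by (intro only) auto
        moreover have "\<bar>S m j\<bar> \<le> B * \<delta>"
          using N by (intro S(4)) auto
        ultimately show ?thesis
          using small_product[OF Sim] by simp
      qed
    qed (use c in auto)
    then show "c \<in> {m}"
      using only[of c] c K by auto
  qed
  have "singular N S i j K \<longleftrightarrow> K = {}" if K: "K \<subseteq> N - {i, j}" for K
  proof
    assume sing: "singular N S i j K"
    \<comment> \<open>By the exact criterion, \<open>(ij|m)\<close> would force
      \<open>S i m = 0\<close>, that is \<open>(im|{})\<close>. Together with \<open>(im|M)\<close>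
      this confines \<open>M\<close> to \<open>j\<close>.\<close>
    have "\<not> singular N S i j {m}"
    proof
      assume "singular N S i j {m}"
      then have "S i m * S m j = 0"
        using singular_singleton_iff[of N i j m S] finite_N N S(3) Sij by simp
      moreover have "\<bar>S m j\<bar> = \<delta> * 3 ^ (f m * f j)"
        using N jm by (intro S(5)) (auto simp: insert_commute)
      ultimately have "S i m = 0"
        using \<delta>(1) by auto
      then have "singular N S i m {}"
        using N by (simp add: singular_empty_iff)
      then have "c = j" if "c \<in> M" for c
        using unique[OF _ im _ M(1), of "{}" c] that by auto
      with M(2) show False by blast
    qed
    then have "K \<noteq> {m}"
      using sing by blast
    with ij_only[OF K sing] show "K = {}"
      by blast
  qed (simp add: ij)
  moreover have "singular N S i m K \<longleftrightarrow> K = M" if K: "K \<subseteq> N - {i, m}" for K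
  proof
    assume sing: "singular N S i m K"
    show "K = M"
    proof (rule ccontr)
      assume "K \<noteq> M"
      \<comment> \<open>If \<open>K\<close> and \<open>M\<close> differ, they are \<open>D\<close>
        and D with \<open>j\<close> added. Weak transitivity then yields \<open>(jm|D)\<close>,
        impossible for an unadjusted pair, or \<open>(ij|D)\<close>, impossible because
        \<open>D\<close> is nonempty and avoids \<open>m\<close>.\<close>
      define D where "D = M - {j}"
      have "sym_diff M K \<subseteq> {j}"
        using unique[OF im sing M(1) K] by blast
      then have "M = D \<and> K = insert j D \<or> K = D \<and> M = insert j D"
        using \<open>K \<noteq> M\<close> unfolding D_def by blast
      then have "singular N S i m D" "singular N S i m (insert j D)"
        using sing im by auto
      moreover have D: "D \<subseteq> N - {i, j, m}" "D \<noteq> {}" "m \<notin> D"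
        using M by (auto simp: D_def)
      ultimately have "singular N S i j D \<or> singular N S j m D"
        using regular_weak_transitivity[OF reg N(1,2,4)] by blast
      moreover have "\<not> singular N S j m D"
        using N D jm by (intro free_nonsingular[OF reg]) auto
      moreover have "\<not> singular N S i j D"
        using ij_only[of D] D by blast
      ultimately show False by blast
    qed
  qed (simp add: im)
  moreover have "{i, j} \<noteq> {i, m}"
    using N by (auto simp: doubleton_eq_iff)
  ultimately show ?thesis
    using N by (intro regular_realizes_pairs[OF reg[unfolded Z_def] assms(1)]) auto
qed

text \<open>For two statements on the same pair \<open>ij\<close>, the entry \<open>S i m\<close> with \<open>m \<in> M\<close> is solved from
  \<open>(ij|M)\<close>. It has exact order \<open>\<delta>\<close>, because \<open>M\<close> has a further element.\<close>

lemma solve_entry_of_sum: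
  assumes N: "i \<in> N" "j \<in> N" "i \<noteq> j" and M: "M \<subseteq> N - {i, j}" "m \<in> M" "M \<noteq> {m}"
    and reg: "regular {{i, j}} S" and Sij: "S i j = 0"
  obtains z where "\<bar>z\<bar> \<le> B * \<delta>" "\<delta> / B \<le> \<bar>z\<bar>" "z \<in> \<rat>"
    "singular N (set_pair i m z S) i j M"
proof -
  note S = regularD[OF reg]
  have M': "M \<subseteq> N - {j}" "i \<notin> M" "finite M" "m \<in> N" "m \<noteq> i" "m \<noteq> j"
    using M finite_N by (auto intro: finite_subset)
  have free: "\<bar>S a b\<bar> = \<delta> * 3 ^ (f a * f b)" if "a \<in> N" "b \<in> N" "a \<noteq> b" "{a, b} \<noteq> {i, j}" for a b
    using that by (intro S(5)) auto
  have upper: "\<bar>S a b\<bar> \<le> R * \<delta>" if "a \<in> N" "b \<in> N" "a \<noteq> b" "{a, b} \<noteq> {i, j}" for a b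
    using free[OF that] entry_le[OF that(1,2)] by simp
  have lower: "\<delta> \<le> \<bar>S a b\<bar>" if "a \<in> N" "b \<in> N" "a \<noteq> b" "{a, b} \<noteq> {i, j}" for a b
    using free[OF that] \<delta>(1) by simp
  \<comment> \<open>The kernel approximation error, computed with \<open>R\<close> instead of
    \<open>B\<close>: the rows in \<open>M\<close> contain only entries of initial size, and the
    slack up to \<open>B\<close> is reserved for the unknown entry.\<close>
  define r where "r = 2 * n * (R * \<delta>)\<^sup>2"
  have R\<delta>: "0 < R * \<delta>" "\<delta> \<le> R * \<delta>"
    using R(1) \<delta>(1) by auto
  have r: "0 \<le> r" "r \<le> \<delta> / 16" "r \<le> B * \<delta> * (\<delta> / 2)"
  proof -
    have "r = (4 * n * R\<^sup>2) * \<delta> * (\<delta> / 2)"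
      by (simp add: r_def power2_eq_square)
    also have "\<dots> \<le> B * \<delta> * (\<delta> / 2)"
      using B(2) \<delta>(1) by (intro mult_right_mono) auto
    finally show r: "r \<le> B * \<delta> * (\<delta> / 2)" .
    have "B * \<delta> * (\<delta> / 2) \<le> (1/8) * (\<delta> / 2)"
      using power_B_\<delta>[of 1] \<delta>(1) by (intro mult_right_mono) auto
    with r show "r \<le> \<delta> / 16" by simp
  qed (simp add: r_def)
  have d: "0 \<le> R * \<delta>" "n * (R * \<delta>) \<le> 1/2"
  proof -
    have "n * (R * \<delta>) \<le> n * (B * \<delta>)"
      using R_le_B by (intro mult_left_mono) auto
    then show "n * (R * \<delta>) \<le> 1/2"
      using card_small by linarith
  qed (use R\<delta> in simp)
  have diag: "S c c = 1" if "c \<in> M" for c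
    using that M S(3) by auto
  have off: "\<bar>S c e\<bar> \<le> R * \<delta>" if "c \<in> M" "e = j \<or> e \<in> M" "c \<noteq> e" for c e
    using that M N M' by (intro upper) (auto simp: doubleton_eq_iff)
  have "r < \<bar>S m j\<bar>"
    using lower[of m j] r \<delta>(1) M' N by (auto simp: doubleton_eq_iff)
  then have "\<not> singular N (S(i := (\<lambda>b. of_bool (b = m)))) i j M"
    using nonsingular_unit_row[where S = S and c = m, OF finite_N N(2) M'(1) d diag off] M(2) M'(2)
    unfolding r_def by blast
  then obtain z where z: "z \<in> \<rat>" "singular N (S(i := (S i)(m := z))) i j M"
    using singular_solve_entry[OF finite_N N M(1), of m S] S(1) M(2) by blast
  let ?S = "S(i := (S i)(m := z))"
  have diag': "?S c c = 1" if "c \<in> M" for c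
    using that diag M'(2) by auto
  have off': "\<bar>?S c e\<bar> \<le> R * \<delta>" if "c \<in> M" "e = j \<or> e \<in> M" "c \<noteq> e" for c e
    using that off M'(2) by auto
  obtain w where w: "?S i j + (\<Sum>c\<in>M. ?S i c * w c) = 0"
    "\<And>c. c \<in> M \<Longrightarrow> \<bar>w c + ?S c j\<bar> \<le> 2 * n * (R * \<delta>)\<^sup>2"
    using singular_approx_vector[where S = ?S, OF finite_N N(2) M'(1) d diag' off' z(2)] by blast
  have w_near: "\<bar>w c + S c j\<bar> \<le> r" if "c \<in> M" for c
  proof -
    have "c \<noteq> i"
      using that M'(2) by auto
    then show ?thesis
      using w(2)[OF that] by (simp add: r_def)
  qed
  let ?s = "\<Sum>c\<in>M - {m}. S i c * w c"
  have "(\<Sum>c\<in>M. ?S i c * w c) = z * w m + ?s"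
    using M' M(2) by (simp add: sum.remove)
  \<comment> \<open>Here |w m| lies between \<delta> / 2 and 2 R \<delta>, and the sum lies between
    \<delta>^2 / 2 and 2 n R^2 \<delta>^2. The resulting bounds on \<open>z\<close> are the origin
    of the two conditions on \<open>B\<close>.\<close>
  then have zw: "z * w m = - ?s"
    using w(1) Sij M' by simp
  have Sic: "\<bar>S i c\<bar> \<le> R * \<delta>" if "c \<in> M" for c
    using that M M' N by (intro upper) (auto simp: doubleton_eq_iff)
  have Scj: "\<bar>S c j\<bar> \<le> R * \<delta>" "\<delta> \<le> \<bar>S c j\<bar>" if "c \<in> M" for c
    using that M M' N by (auto intro!: upper lower simp: doubleton_eq_iff)
  have w_upper: "\<bar>w c\<bar> \<le> 2 * (R * \<delta>)" if "c \<in> M" for c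
    using w_near[OF that] Scj[OF that] r R\<delta> \<delta>(1) by linarith
  have w_lower: "\<delta> / 2 \<le> \<bar>w c\<bar>" if "c \<in> M" for c
    using w_near[OF that] Scj[OF that] r \<delta>(1) by linarith
  have card: "real (card (M - {m})) \<le> n"
    using M finite_N by (intro of_nat_mono card_mono) auto
  have s_upper: "\<bar>?s\<bar> \<le> B * \<delta> * (\<delta> / 2)"
  proof -
    have "\<bar>?s\<bar> \<le> (\<Sum>c\<in>M - {m}. \<bar>S i c\<bar> * \<bar>w c\<bar>)"
      by (metis (no_types, lifting) abs_mult sum.cong sum_abs)
    also have "\<dots> \<le> (\<Sum>c\<in>M - {m}. (R * \<delta>) * (2 * (R * \<delta>)))"
      using Sic w_upper R\<delta> by (intro sum_mono mult_mono) auto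
    also have "\<dots> = real (card (M - {m})) * ((R * \<delta>) * (2 * (R * \<delta>)))"
      by simp
    also have "\<dots> \<le> n * ((R * \<delta>) * (2 * (R * \<delta>)))"
      using card R\<delta> by (intro mult_right_mono) auto
    also have "\<dots> = (4 * n * R\<^sup>2) * \<delta> * (\<delta> / 2)"
      by (simp add: power2_eq_square)
    also have "\<dots> \<le> B * \<delta> * (\<delta> / 2)"
      using B(2) \<delta>(1) by (intro mult_right_mono) auto
    finally show ?thesis .
  qed
  have s_lower: "\<delta>\<^sup>2 / 2 \<le> \<bar>?s\<bar>"
  proof -
    have "\<delta>\<^sup>2 \<le> \<bar>\<Sum>c\<in>M - {m}. S i c * S c j\<bar>"
    proof (rule product_sum_ge[OF reg N])
      show "M - {m} \<subseteq> N - {i, j}" "M - {m} \<noteq> {}"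
        using M by auto
      show "{i, c} \<notin> {{i, j}} \<and> {c, j} \<notin> {{i, j}}" if "c \<in> M - {m}" for c
        using that M N by (auto simp: doubleton_eq_iff)
    qed simp
    moreover have "\<bar>?s + (\<Sum>c\<in>M - {m}. S i c * S c j)\<bar> \<le> \<delta>\<^sup>2 / 2"
    proof -
      have "?s + (\<Sum>c\<in>M - {m}. S i c * S c j) = (\<Sum>c\<in>M - {m}. S i c * (w c + S c j))"
        by (simp add: distrib_left sum.distrib)
      also have "\<bar>\<dots>\<bar> \<le> (\<Sum>c\<in>M - {m}. \<bar>S i c\<bar> * \<bar>w c + S c j\<bar>)"
        by (metis (no_types, lifting) abs_mult sum.cong sum_abs)
      also have "\<dots> \<le> (\<Sum>c\<in>M - {m}. (R * \<delta>) * r)"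
        using Sic w_near R\<delta> by (intro sum_mono mult_mono) auto
      also have "\<dots> = real (card (M - {m})) * ((R * \<delta>) * r)"
        by simp
      also have "\<dots> \<le> n * ((R * \<delta>) * r)"
        using card R\<delta> r(1) by (intro mult_right_mono) auto
      also have "\<dots> = (n * (R * \<delta>)) * r"
        by simp
      also have "\<dots> \<le> (B * (B * \<delta>)) * (B * \<delta> * (\<delta> / 2))"
        using B(1) R(1) \<delta>(1) card_le_B r(1,3) B_ge_1 by (intro mult_mono) auto
      also have "\<dots> = B ^ 3 * \<delta> * (\<delta>\<^sup>2 / 2)"
        by (simp add: power2_eq_square power3_eq_cube)
      also have "\<dots> \<le> 1 * (\<delta>\<^sup>2 / 2)"
        using power_B_\<delta>[of 3] by (intro mult_right_mono) auto
      also have "\<dots> = \<delta>\<^sup>2 / 2"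
        by simp
      finally show ?thesis .
    qed
    ultimately show ?thesis
      by linarith
  qed
  have abs_zw: "\<bar>z\<bar> * \<bar>w m\<bar> = \<bar>?s\<bar>"
    using zw by (metis abs_minus_cancel abs_mult)
  have "\<bar>z\<bar> \<le> B * \<delta>"
  proof -
    have "\<bar>z\<bar> * (\<delta> / 2) \<le> \<bar>z\<bar> * \<bar>w m\<bar>"
      using w_lower[OF M(2)] by (intro mult_left_mono) auto
    then have "\<bar>z\<bar> * (\<delta> / 2) \<le> B * \<delta> * (\<delta> / 2)"
      using abs_zw s_upper by linarith
    then show ?thesis
      using \<delta>(1) by simp
  qed
  moreover have "\<delta> / B \<le> \<bar>z\<bar>"
  proof -
    have "\<bar>z\<bar> * \<bar>w m\<bar> \<le> \<bar>z\<bar> * (2 * (R * \<delta>))"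
      using w_upper[OF M(2)] by (intro mult_left_mono) auto
    then have "\<delta>\<^sup>2 \<le> \<bar>z\<bar> * (4 * R * \<delta>)"
      using abs_zw s_lower by linarith
    also have "\<dots> \<le> \<bar>z\<bar> * (B * \<delta>)"
      using B(1) \<delta>(1) by (intro mult_left_mono mult_right_mono) auto
    finally have "\<delta> * \<delta> \<le> (\<bar>z\<bar> * B) * \<delta>"
      by (simp add: power2_eq_square mult.assoc)
    then have "\<delta> \<le> \<bar>z\<bar> * B"
      using \<delta>(1) by simp
    then show ?thesis
      using B_ge_1 by (simp add: pos_divide_le_eq)
  qed
  moreover have "singular N (set_pair i m z S) i j M"
  proof -
    have "singular N (set_pair i m z S) i j M \<longleftrightarrow> singular N ?S i j M"
      using M M' N by (intro singular_cong) (auto simp: set_pair_def)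
    then show ?thesis
      using z(2) by simp
  qed
  ultimately show thesis
    using that z(1) by blast
qed

text \<open>The entry of im is not a prescribed power of 3, so the expansion ignores
  \<open>m\<close>. This is harmless, since exactly one of the two desired conditioning sets
  contains \<open>m\<close>.\<close>

lemma realizes_parallel:
  assumes "B * \<delta> < d" and N: "i \<in> N" "j \<in> N" "i \<noteq> j"
    and M: "M \<subseteq> N - {i, j}" "m \<in> M" "M \<noteq> {m}"
  shows "\<exists>S. realizes N T {ci i j {}, ci i j M} d S"
proof -
  have m: "m \<in> N" "m \<noteq> i" "m \<noteq> j"
    using M by auto
  define S0 where "S0 = set_pair i j 0 weight"
  have reg0: "regular {{i, j}} S0"
    unfolding S0_def using regular_zero[OF regular_weight] N by simp
  have "S0 i j = 0"
    by (simp add: S0_def set_pair_def)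
  from solve_entry_of_sum[OF N M reg0 this] obtain z where z: "\<bar>z\<bar> \<le> B * \<delta>" "\<delta> / B \<le> \<bar>z\<bar>" "z \<in> \<rat>"
    "singular N (set_pair i m z S0) i j M" .
  define S where "S = set_pair i m z S0"
  define Z where "Z = {{i, m}, {i, j}}"
  have reg: "regular Z S"
    unfolding Z_def S_def using N m z by (intro regular_set_pair[OF reg0]) auto
  have sing_M: "singular N S i j M"
    using z(4) by (simp add: S_def)
  have "S i j = 0" and Sim: "S i m = z"
    using N m by (auto simp: S_def S0_def set_pair_def)
  then have empty: "singular N S i j {}"
    using N by (simp add: singular_empty_iff)
  have only: "c = m" if "{i, c} \<in> Z \<or> {c, j} \<in> Z" "c \<notin> {i, j}" for c
    using that m N by (auto simp: Z_def doubleton_eq_iff)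
  have unique: "C = C'"
    if sing: "singular N S i j C" "singular N S i j C'" and C: "C \<subseteq> N - {i, j}" "C' \<subseteq> N - {i, j}"
      and "m \<notin> sym_diff C C'" for C C'
  proof -
    have no: "\<not> ({i, c} \<in> Z \<or> {c, j} \<in> Z)" if "c \<in> sym_diff C C'" for c
      using only[of c] that C \<open>m \<notin> sym_diff C C'\<close> by blast
    have "{i, c} \<in> Z \<or> {c, j} \<in> Z" if "c \<in> sym_diff C C'" for c
      by (rule singular_unique[OF reg N C sing _ that]) (use no in blast)
    with no show ?thesis by blast
  qed
  have "singular N S i j K \<longleftrightarrow> K = {} \<or> K = M" if K: "K \<subseteq> N - {i, j}" for K
  proof
    assume sing: "singular N S i j K"
    show "K = {} \<or> K = M"
    \<comment> \<open>Compare \<open>K\<close> with whichever of \<open>M\<close> and the empty set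
      agrees with it about \<open>m\<close>; then \<open>m\<close> is absent from the symmetric
      difference.\<close>
    proof (cases "m \<in> K")
      case True
      with M(2) have "m \<notin> sym_diff K M" by simp
      with unique[OF sing sing_M K M(1)] show ?thesis by blast
    next
      case False
      then have "m \<notin> sym_diff K {}" by simp
      with unique[OF sing empty K] show ?thesis by blast
    qed
  qed (use empty sing_M in auto)
  \<comment> \<open>The lower bound on \<open>z\<close> is needed here: although adjusted, the pair
    im must not satisfy any statement.\<close>
  moreover have "\<not> singular N S i m K" if "K \<subseteq> N - {i, m}" for K
    using that N m z(2) Sim by (intro large_entry_nonsingular[OF reg]) auto
  moreover have "{i, j} \<noteq> {i, m}"
    using m by (auto simp: doubleton_eq_iff)
  ultimately show ?thesis
    using N m by (intro regular_realizes_pairs[OF reg[unfolded Z_def] assms(1)]) auto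
qed

end

section \<open>Minimal gaussoid extensions\<close>

lemma gaussoid_axioms:
  assumes "gaussoid N G" "i \<in> N" "j \<in> N" "k \<in> N" "i \<noteq> j" "i \<noteq> k" "j \<noteq> k" "L \<subseteq> N - {i, j, k}"
  shows "ci i j L \<in> G \<and> ci i k (insert j L) \<in> G \<longleftrightarrow> ci i k L \<in> G \<and> ci i j (insert k L) \<in> G"
    "ci i j (insert k L) \<in> G \<and> ci i k (insert j L) \<in> G \<longleftrightarrow> ci i j L \<in> G \<and> ci i k L \<in> G"
    "ci i j L \<in> G \<Longrightarrow> ci i j (insert k L) \<in> G \<Longrightarrow> ci i k L \<in> G \<or> ci j k L \<in> G"
proof -
  have "i \<noteq> j \<and> i \<noteq> k \<and> j \<noteq> k \<and> L \<subseteq> N - {i, j, k}"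
    using assms by blast
  note mp[OF assms(1)[unfolded gaussoid_def, THEN conjunct2, THEN bspec[OF _ assms(2)],
    THEN bspec[OF _ assms(3)], THEN bspec[OF _ assms(4)], THEN spec[of _ L]] this]
  then show "ci i j L \<in> G \<and> ci i k (insert j L) \<in> G \<longleftrightarrow> ci i k L \<in> G \<and> ci i j (insert k L) \<in> G"
    "ci i j (insert k L) \<in> G \<and> ci i k (insert j L) \<in> G \<longleftrightarrow> ci i j L \<in> G \<and> ci i k L \<in> G"
    "ci i j L \<in> G \<Longrightarrow> ci i j (insert k L) \<in> G \<Longrightarrow> ci i k L \<in> G \<or> ci j k L \<in> G"
    by argo+
qed

definition square :: "'a \<Rightarrow> 'a \<Rightarrow> 'a \<Rightarrow> 'a set \<Rightarrow> 'a ci_stmt set" where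
  "square i j k L = {ci i j L, ci i k L, ci i j (insert k L), ci i k (insert j L)}"

text \<open>Membership splits into a condition on the pair and one on the conditioning set, because
  the index of j, k that belongs to the pair cannot occur in \<open>M\<close>.\<close>

lemma ci_in_square_iff:
  assumes "i \<noteq> j" "i \<noteq> k" "j \<noteq> k" "L \<inter> {i, j, k} = {}" "a \<noteq> b" "a \<notin> M" "b \<notin> M"
  shows "ci a b M \<in> square i j k L \<longleftrightarrow>
    (a = i \<and> b \<in> {j, k} \<or> b = i \<and> a \<in> {j, k}) \<and> M - {j, k} = L"
proof -
  consider "{a, b} = {i, j}" | "{a, b} = {i, k}" | "{a, b} \<noteq> {i, j}" "{a, b} \<noteq> {i, k}"
    by blast
  then show ?thesis
  proof cases
    case 1
    then have "j \<notin> M" "a = i \<and> b = j \<or> a = j \<and> b = i"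
      using assms(6,7) by (auto simp: doubleton_eq_iff)
    moreover have "{a, b} \<noteq> {i, k}"
      using 1 assms(1-3) by (auto simp: doubleton_eq_iff)
    moreover have "M = L \<or> M = insert k L \<longleftrightarrow> M - {j, k} = L"
      using \<open>j \<notin> M\<close> assms(4) by auto
    ultimately show ?thesis
      using 1 by (auto simp: square_def)
  next
    case 2
    then have "k \<notin> M" "a = i \<and> b = k \<or> a = k \<and> b = i"
      using assms(6,7) by (auto simp: doubleton_eq_iff)
    moreover have "{a, b} \<noteq> {i, j}"
      using 2 assms(1-3) by (auto simp: doubleton_eq_iff)
    moreover have "M = L \<or> M = insert j L \<longleftrightarrow> M - {j, k} = L"
      using \<open>k \<notin> M\<close> assms(4) by auto
    ultimately show ?thesis
      using 2 by (auto simp: square_def)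
  next
    case 3
    then show ?thesis
      by (auto simp: square_def)
  qed
qed

lemma gaussoid_square:
  assumes N: "i \<in> N" "j \<in> N" "k \<in> N" "i \<noteq> j" "i \<noteq> k" "j \<noteq> k" "L \<subseteq> N - {i, j, k}"
  shows "gaussoid N (square i j k L)"
proof -
  have subset: "square i j k L \<subseteq> ci_statements N"
  proof
    fix s assume "s \<in> square i j k L"
    then consider "s = ci i j L" | "s = ci i k L" | "s = ci i j (insert k L)" | "s = ci i k (insert j L)"
      unfolding square_def by blast
    then show "s \<in> ci_statements N"
      unfolding ci_statements_def using N by cases blast+
  qed
  show ?thesis
    unfolding gaussoid_def
  proof (rule conjI[OF subset], intro ballI allI impI)
    fix a b c M assume abc: "a \<noteq> b \<and> a \<noteq> c \<and> b \<noteq> c \<and> M \<subseteq> N - {a, b, c}"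
    have L: "L \<inter> {i, j, k} = {}" and M: "a \<notin> M" "b \<notin> M" "c \<notin> M"
      using N(7) abc by auto
    have ins: "M - {j, k} = L \<and> insert e M - {j, k} = L \<longleftrightarrow> M - {j, k} = L \<and> e \<in> {j, k}"
      if "e \<notin> M" for e
      using that by auto
    have mem: "ci p q K \<in> square i j k L \<longleftrightarrow>
      (p = i \<and> q \<in> {j, k} \<or> q = i \<and> p \<in> {j, k}) \<and> K - {j, k} = L"
      if "p \<noteq> q" "p \<notin> K" "q \<notin> K" for p q K
      using ci_in_square_iff[OF N(4-6) L that] .
    have ins': "insert e M - {j, k} = M - {j, k}" if "e \<in> {j, k}" for e
      using that by auto
    \<comment> \<open>With the conditions on conditioning set and pair abstracted to
      \<open>P\<close> and \<open>E\<close>, the axioms become propositional consequences of a few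
      facts about them.\<close>
    define P where "P K \<longleftrightarrow> K - {j, k} = L" for K
    define E where "E p q \<longleftrightarrow> p = i \<and> q \<in> {j, k} \<or> q = i \<and> p \<in> {j, k}" for p q
    have E: "E a b \<Longrightarrow> E a c \<Longrightarrow> a = i \<and> b \<in> {j, k} \<and> c \<in> {j, k}"
      using abc N(4-6) by (auto simp: E_def)
    have E3: "E a b \<Longrightarrow> c \<in> {j, k} \<Longrightarrow> E a c \<or> E b c"
      using abc N(4-6) by (auto simp: E_def)
    have P: "P M \<Longrightarrow> e \<in> {j, k} \<longleftrightarrow> P (insert e M)" "e \<in> {j, k} \<Longrightarrow> P M \<longleftrightarrow> P (insert e M)"
      if "e \<notin> M" for e
      using ins[OF that] ins'[of e] by (auto simp: P_def)
    have "ci a b M \<in> square i j k L \<longleftrightarrow> E a b \<and> P M"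
      "ci a c M \<in> square i j k L \<longleftrightarrow> E a c \<and> P M"
      "ci b c M \<in> square i j k L \<longleftrightarrow> E b c \<and> P M"
      "ci a b (insert c M) \<in> square i j k L \<longleftrightarrow> E a b \<and> P (insert c M)"
      "ci a c (insert b M) \<in> square i j k L \<longleftrightarrow> E a c \<and> P (insert b M)"
      unfolding E_def P_def using abc M by (intro mem; auto)+
    then show "(ci a b M \<in> square i j k L \<and> ci a c (insert b M) \<in> square i j k L \<longleftrightarrow>
        ci a c M \<in> square i j k L \<and> ci a b (insert c M) \<in> square i j k L) \<and>
     (ci a b (insert c M) \<in> square i j k L \<and> ci a c (insert b M) \<in> square i j k L \<longleftrightarrow>
        ci a b M \<in> square i j k L \<and> ci a c M \<in> square i j k L) \<and>
     (ci a b M \<in> square i j k L \<and> ci a b (insert c M) \<in> square i j k L \<longrightarrow>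
        ci a c M \<in> square i j k L \<or> ci b c M \<in> square i j k L)"
      using E E3 P[OF M(2)] P[OF M(3)] by argo
  qed
qed

lemma eq_doubleton_if_card_le_2:
  assumes "finite L" "card L \<le> 2" "p \<in> L" "q \<in> L" "p \<noteq> q"
  shows "L = {p, q}"
  using assms card_seteq[of L "{p, q}"] by auto

lemma square_subset:
  assumes G: "gaussoid N G" and N: "i \<in> N" "j \<in> N" "k \<in> N" "i \<noteq> j" "i \<noteq> k" "j \<noteq> k" "M \<subseteq> N - {i, j, k}"
    and "ci i j M \<in> G" "ci i k M \<in> G"
  shows "square i j k M \<subseteq> G"
  using gaussoid_axioms[OF G N] assms(9,10) unfolding square_def by blast

text \<open>The premises of a violated axiom are two distinct statements and therefore exhaust
  \<open>L\<close>; in any gaussoid they generate a full square. For axiom (iii) the square depends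
  on which alternative \<open>G\<close> satisfies.\<close>

lemma nongaussoid_pair_in_square:
  assumes L: "L \<subseteq> ci_statements N" "finite L" "card L \<le> 2" "\<not> gaussoid N L"
    and G: "gaussoid N G" "L \<subseteq> G"
  obtains i j k M where "i \<in> N" "j \<in> N" "k \<in> N" "i \<noteq> j" "i \<noteq> k" "j \<noteq> k" "M \<subseteq> N - {i, j, k}"
    "L \<subseteq> square i j k M" "square i j k M \<subseteq> G"
proof -
  obtain i j k M where N: "i \<in> N" "j \<in> N" "k \<in> N" "i \<noteq> j" "i \<noteq> k" "j \<noteq> k" "M \<subseteq> N - {i, j, k}"
    and viol: "\<not> ((ci i j M \<in> L \<and> ci i k (insert j M) \<in> L \<longleftrightarrow> ci i k M \<in> L \<and> ci i j (insert k M) \<in> L) \<and>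
        (ci i j (insert k M) \<in> L \<and> ci i k (insert j M) \<in> L \<longleftrightarrow> ci i j M \<in> L \<and> ci i k M \<in> L) \<and>
        (ci i j M \<in> L \<and> ci i j (insert k M) \<in> L \<longrightarrow> ci i k M \<in> L \<or> ci j k M \<in> L))"
    using L(1,4) unfolding gaussoid_def by blast
  have M: "i \<notin> M" "j \<notin> M" "k \<notin> M"
    using N(7) by auto
  note ax = gaussoid_axioms[OF G(1) N]
  note pair = eq_doubleton_if_card_le_2[OF L(2,3)]
  have ne: "{i, j} \<noteq> {i, k}" "M \<noteq> insert k M"
    using N M by (auto simp: doubleton_eq_iff)
  consider (a) "ci i j M \<in> L" "ci i k (insert j M) \<in> L" | (b) "ci i k M \<in> L" "ci i j (insert k M) \<in> L"
    | (c) "ci i j (insert k M) \<in> L" "ci i k (insert j M) \<in> L" | (d) "ci i j M \<in> L" "ci i k M \<in> L"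
    | (e) "ci i j M \<in> L" "ci i j (insert k M) \<in> L"
    using viol by argo
  then show thesis
  proof cases
    case a
    have "L = {ci i j M, ci i k (insert j M)}"
      using a ne by (intro pair) auto
    then have "L \<subseteq> square i j k M"
      by (simp add: square_def)
    moreover have "square i j k M \<subseteq> G"
      using a G ax by (intro square_subset[OF G(1) N]) blast+
    ultimately show thesis by (rule that[OF N])
  next
    case b
    have "L = {ci i k M, ci i j (insert k M)}"
      using b ne by (intro pair) auto
    then have "L \<subseteq> square i j k M"
      by (simp add: square_def)
    moreover have "square i j k M \<subseteq> G"
      using b G ax by (intro square_subset[OF G(1) N]) blast+
    ultimately show thesis by (rule that[OF N])
  next
    case c
    have "L = {ci i j (insert k M), ci i k (insert j M)}"
      using c ne by (intro pair) auto
    then have "L \<subseteq> square i j k M"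
      by (simp add: square_def)
    moreover have "square i j k M \<subseteq> G"
      using c G ax by (intro square_subset[OF G(1) N]) blast+
    ultimately show thesis by (rule that[OF N])
  next
    case d
    have "L = {ci i j M, ci i k M}"
      using d ne by (intro pair) auto
    then have "L \<subseteq> square i j k M"
      by (simp add: square_def)
    moreover have "square i j k M \<subseteq> G"
      using d G by (intro square_subset[OF G(1) N]) blast+
    ultimately show thesis by (rule that[OF N])
  next
    case e
    have L: "L = {ci i j M, ci i j (insert k M)}"
      using e ne by (intro pair) auto
    have "ci i k M \<in> G \<or> ci j k M \<in> G"
      using ax(3) e G(2) by blast
    then show thesis
    proof
      assume "ci i k M \<in> G"
      then have "square i j k M \<subseteq> G"
        using e G by (intro square_subset[OF G(1) N]) blast+
      then show thesis
        using L by (intro that[OF N]) (simp_all add: square_def)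
    next
      assume jk: "ci j k M \<in> G"
      have N': "j \<in> N" "i \<in> N" "k \<in> N" "j \<noteq> i" "j \<noteq> k" "i \<noteq> k" "M \<subseteq> N - {j, i, k}"
        using N by auto
      have "ci j i M \<in> G"
        using e(1) G(2) by (auto simp: insert_commute)
      then have "square j i k M \<subseteq> G"
        using jk by (intro square_subset[OF G(1) N'])
      moreover have "L \<subseteq> square j i k M"
        using L by (simp add: square_def insert_commute)
      ultimately show thesis
        by (intro that[OF N'])
    qed
  qed
qed

lemma minimal_gaussoid_extension_cases:
  assumes "finite N" "L \<subseteq> ci_statements N" "card L \<le> 2" "minimal_gaussoid_extension N L G"
  obtains (small) "G = L" "gaussoid N L" | (square) i j k M where "i \<in> N" "j \<in> N" "k \<in> N"
    "i \<noteq> j" "i \<noteq> k" "j \<noteq> k" "M \<subseteq> N - {i, j, k}" "G = square i j k M"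
proof -
  have G: "gaussoid N G" "L \<subseteq> G" and min: "\<And>H. gaussoid N H \<Longrightarrow> L \<subseteq> H \<Longrightarrow> H \<subseteq> G \<Longrightarrow> H = G"
    using assms(4) unfolding minimal_gaussoid_extension_def by blast+
  show thesis
  proof (cases "gaussoid N L")
    case True
    then show thesis
      using min[of L] G(2) small by blast
  next
    case False
    have "ci_statements N \<subseteq> Pow N \<times> Pow N"
      unfolding ci_statements_def by auto
    then have "finite L"
      using assms(1,2) by (meson finite_Pow_iff finite_SigmaI finite_subset)
    then obtain i j k M where N: "i \<in> N" "j \<in> N" "k \<in> N" "i \<noteq> j" "i \<noteq> k" "j \<noteq> k" "M \<subseteq> N - {i, j, k}"
      and "L \<subseteq> square i j k M" "square i j k M \<subseteq> G"
      by (rule nongaussoid_pair_in_square[OF assms(2) _ assms(3) False G])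
    then have "G = square i j k M"
      using min[OF gaussoid_square[OF N]] by simp
    with N show thesis
      by (rule square)
  qed
qed

text \<open>Two statements on one pair whose conditioning sets differ by \<open>m\<close> alone
  would force, by axiom (iii), a statement on another pair. This gives the condition
  \<open>M \<noteq> {m}\<close> of \<open>realizes_parallel\<close> after toggling by
  \<open>K\<close>.\<close>

lemma parallel_pair_far:
  assumes G: "gaussoid N {ci i j K, ci i j M}" and N: "i \<in> N" "j \<in> N" "i \<noteq> j" "K \<subseteq> N - {i, j}" "M \<subseteq> N - {i, j}"
    and m: "m \<in> N" "m \<notin> {i, j}"
  shows "sym_diff M K \<noteq> {m}"
proof
  assume sd: "sym_diff M K = {m}"
  have eq: "M - {m} = K - {m}"
  proof (rule Set.set_eqI)
    fix c
    have "c \<in> sym_diff M K \<longleftrightarrow> c = m"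
      using sd by simp
    then show "c \<in> M - {m} \<longleftrightarrow> c \<in> K - {m}"
      by auto
  qed
  have "m \<in> sym_diff M K"
    using sd by simp
  define D where "D = M - {m}"
  have D: "D \<subseteq> N - {i, j, m}"
    using N(5) by (auto simp: D_def)
  have "ci i j D \<in> {ci i j K, ci i j M} \<and> ci i j (insert m D) \<in> {ci i j K, ci i j M}"
  proof (cases "m \<in> M")
    case True
    with \<open>m \<in> sym_diff M K\<close> have "M = insert m D" "K = D"
      using eq by (auto simp: D_def)
    then show ?thesis by simp
  next
    case False
    with \<open>m \<in> sym_diff M K\<close> have "K = insert m D" "M = D"
      using eq by (auto simp: D_def)
    then show ?thesis by simp
  qed
  moreover have "i \<noteq> m" "j \<noteq> m"
    using m(2) by auto
  ultimately have "ci i m D \<in> {ci i j K, ci i j M} \<or> ci j m D \<in> {ci i j K, ci i j M}"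
    using gaussoid_axioms(3)[OF G N(1,2) m(1) N(3) _ _ D] by blast
  then show False
    using N(3) m(2) by (auto simp: doubleton_eq_iff)
qed

text \<open>Otherwise both statements would belong to one square, and axioms (i) and (ii) would
  force the rest of it. This is the nondegeneracy condition of \<open>realizes_adjacent\<close>
  after toggling by \<open>K\<close>.\<close>

lemma adjacent_pair_far:
  assumes G: "gaussoid N {ci i j K, ci i m M}" and N: "i \<in> N" "j \<in> N" "m \<in> N" "i \<noteq> j" "i \<noteq> m" "j \<noteq> m"
    and K: "K \<subseteq> N - {i, j}" and M: "M \<subseteq> N - {i, m}"
  shows "sym_diff M K - {i, m} - {j} \<noteq> {}"
proof
  let ?G = "{ci i j K, ci i m M}"
  assume sd: "sym_diff M K - {i, m} - {j} = {}"
  define D where "D = K - {m}"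
  have D: "D \<subseteq> N - {i, j, m}"
    using K by (auto simp: D_def)
  have "K = D \<or> K = insert m D"
    by (auto simp: D_def)
  moreover have "M - {j} = D"
    using sd K M N unfolding D_def by blast
  then have "M = D \<or> M = insert j D"
    by auto
  moreover have "ci i j K \<in> ?G" "ci i m M \<in> ?G"
    by simp_all
  ultimately have "ci i j D \<in> ?G \<and> ci i j (insert m D) \<in> ?G"
    using gaussoid_axioms(1,2)[OF G N D] by metis
  moreover have "{i, j} \<noteq> {i, m}" "insert m D \<noteq> D"
    using N D by (auto simp: doubleton_eq_iff)
  ultimately show False
    by auto
qed

section \<open>Choice of the constants and reduction by pivots\<close>

lemma realizable_if_weights:
  assumes "finite N"
    and real: "\<And>f R B \<delta> d. weights N f R B \<delta> \<Longrightarrow> B * \<delta> < d \<Longrightarrow> \<exists>S. realizes N T G d S"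
  shows "realizable N T G"
  unfolding realizable_def
proof (intro allI impI)
  fix d :: real assume "0 < d"
  obtain f0 :: "'a \<Rightarrow> nat" where f0: "inj_on f0 N"
    using finite_imp_inj_to_nat_seg[OF assms(1)] by blast
  \<comment> \<open>The shift by one makes the weights positive.\<close>
  define f where "f a = Suc (f0 a)" for a
  define R :: real where "R = 1 + (\<Sum>(a, b)\<in>N \<times> N. 3 ^ (f a * f b))"
  \<comment> \<open>Adding the two required lower bounds satisfies both, as both are
    nonnegative.\<close>
  define B where "B = 4 * R + 4 * real (card N) * R\<^sup>2"
  have "0 \<le> (\<Sum>(a, b)\<in>N \<times> N. 3 ^ (f a * f b) :: real)"
    by (intro sum_nonneg) auto
  then have R: "1 \<le> R"
    by (simp add: R_def)
  have R': "3 ^ (f a * f b) \<le> R" if "a \<in> N" "b \<in> N" for a b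
  proof -
    have "(\<lambda>(a, b). 3 ^ (f a * f b) :: real) (a, b) \<le> (\<Sum>(a, b)\<in>N \<times> N. 3 ^ (f a * f b))"
      using that assms(1) by (intro member_le_sum) auto
    then show ?thesis
      by (simp add: R_def)
  qed
  have "4 * R \<le> B" "4 * real (card N) * R\<^sup>2 \<le> B"
    using R by (simp_all add: B_def)
  then have B: "0 < B" using R by linarith
  have "0 < min (1 / (8 * B ^ 6)) (d / B)"
    using B \<open>0 < d\<close> by simp
  \<comment> \<open>\<delta> is chosen last: its bound depends on all other constants and on the
    distance \<open>d\<close>, and density of the rationals supplies a rational value.\<close>
  then obtain \<delta> where \<delta>: "\<delta> \<in> \<rat>" "0 < \<delta>" "\<delta> < min (1 / (8 * B ^ 6)) (d / B)"
    using Rats_dense_in_real by blast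
  have "\<delta> < 1 / (8 * B ^ 6)" "\<delta> < d / B"
    using \<delta>(3) by auto
  then have "8 * B ^ 6 * \<delta> \<le> 1" "B * \<delta> < d"
    using B by (auto simp: field_simps)
  moreover have "weights N f R B \<delta>"
    using assms(1) f0 R R' \<open>4 * R \<le> B\<close> \<open>4 * real (card N) * R\<^sup>2 \<le> B\<close> \<delta> calculation
    by unfold_locales (auto simp: f_def inj_on_def)
  ultimately show "\<exists>S. realizes N T G d S"
    using real by blast
qed

lemma realizable_singleton:
  assumes "finite N" "i \<in> N" "j \<in> N" "i \<noteq> j" "K \<subseteq> N - {i, j}"
  shows "realizable N {} {ci i j K}"
proof (rule realizable_toggle[OF assms(1)])
  show "realizable N K (toggle K ` {ci i j K})"
  proof (rule realizable_if_weights[OF assms(1)])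
    fix f R B \<delta> d assume "weights N f R B \<delta>" "B * \<delta> < d"
    then show "\<exists>S. realizes N K (toggle K ` {ci i j K}) d S"
      using weights.realizes_singleton[of N f R B \<delta> d i j K] assms by (simp add: toggle_def)
  qed
qed (use assms in auto)

lemma realizable_square:
  assumes "finite N" and N: "i \<in> N" "j \<in> N" "k \<in> N" "i \<noteq> j" "i \<noteq> k" "j \<noteq> k" "L \<subseteq> N - {i, j, k}"
  shows "realizable N {} (square i j k L)"
proof (rule realizable_toggle[OF assms(1)])
  have L: "i \<notin> L" "j \<notin> L" "k \<notin> L"
    using N(7) by auto
  have "sym_diff (insert e L) L = {e}" if "e \<notin> L" for e
    using that by auto
  then have toggle: "toggle L ` square i j k L = {ci i j {}, ci i k {}, ci i j {k}, ci i k {j}}"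
    using N(4-6) L unfolding square_def image_insert image_empty toggle_ci by simp
  show "realizable N L (toggle L ` square i j k L)"
    unfolding toggle
  proof (rule realizable_if_weights[OF assms(1)])
    fix f R B \<delta> d assume "weights N f R B \<delta>" "B * \<delta> < d"
    then show "\<exists>S. realizes N L {ci i j {}, ci i k {}, ci i j {k}, ci i k {j}} d S"
      using weights.realizes_square[of N f R B \<delta> d i j k L] N by blast
  qed
  show "K \<inter> p = {}" if "(p, K) \<in> square i j k L" for p K
    using that N(4-6) L by (auto simp: square_def)
qed (use N in auto)

lemma realizable_pair:
  assumes "finite N" and N: "i \<in> N" "j \<in> N" "i \<noteq> j" "K \<subseteq> N - {i, j}" "k \<in> N" "l \<in> N" "k \<noteq> l" "M \<subseteq> N - {k, l}"
    and ne: "ci i j K \<noteq> ci k l M" and G: "gaussoid N {ci i j K, ci k l M}"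
  shows "realizable N {} {ci i j K, ci k l M}"
proof (rule realizable_toggle[OF assms(1)])
  let ?M = "sym_diff M K - {k, l}"
  have "sym_diff K K - {i, j} = {}"
    by auto
  then have toggle: "toggle K ` {ci i j K, ci k l M} = {ci i j {}, ci k l ?M}"
    by (simp add: toggle_def)
  have M: "?M \<subseteq> N - {k, l}"
    using N by auto
  show "realizable N K (toggle K ` {ci i j K, ci k l M})"
    unfolding toggle
  proof (rule realizable_if_weights[OF assms(1)])
    fix f R B \<delta> d assume w: "weights N f R B \<delta>" and d: "B * \<delta> < d"
    \<comment> \<open>The shared index can stand in four positions; writing it as \<open>p\<close>
      reduces these to one case.\<close>
    have adjacent: "\<exists>S. realizes N K {ci i j {}, ci k l ?M} d S"
      if eq: "{i, j} = {p, q}" "{k, l} = {p, m}" and pqm: "p \<noteq> q" "p \<noteq> m" "q \<noteq> m" for p q m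
    proof -
      have pN: "p \<in> N" "q \<in> N" "m \<in> N"
        using eq N by (auto simp: doubleton_eq_iff)
      have "sym_diff M K - {p, m} - {q} \<noteq> {}"
        using G N pN pqm unfolding eq by (intro adjacent_pair_far)
      then have "\<exists>S. realizes N K {ci p q {}, ci p m (sym_diff M K - {p, m})} d S"
        using pN pqm M unfolding eq
        by (intro weights.realizes_adjacent[OF w d])
      then show ?thesis
        unfolding eq .
    qed
    consider (disjoint) "{i, j} \<inter> {k, l} = {}" | (parallel) "{k, l} = {i, j}"
      | "i = k" "j \<noteq> l" | "i = l" "j \<noteq> k" | "j = k" "i \<noteq> l" | "j = l" "i \<noteq> k"
      by blast
    then show "\<exists>S. realizes N K {ci i j {}, ci k l ?M} d S"
    proof cases
      case disjoint
      then show ?thesis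
        using weights.realizes_disjoint[OF w d N(1-3,5-7) _ M] by blast
    next
      case parallel
      have "M \<noteq> K"
        using ne parallel by auto
      moreover have M': "M \<subseteq> N - {i, j}"
        using N(8) parallel by simp
      moreover have sd: "?M = sym_diff M K"
        using M' N(4) parallel by auto
      ultimately obtain m where m: "m \<in> ?M"
        by auto
      then have "m \<in> N" "m \<notin> {i, j}"
        using M parallel by auto
      then have "?M \<noteq> {m}"
        unfolding sd using parallel_pair_far[of N i j K M m] G N M' parallel by simp
      then show ?thesis
        using weights.realizes_parallel[OF w d N(1-3), of ?M m K] M m parallel by simp
    next
      case 3
      then show ?thesis using N by (intro adjacent[of i j l]) auto
    next
      case 4
      then show ?thesis using N by (intro adjacent[of i j k]) auto
    next
      case 5
      then show ?thesis using N by (intro adjacent[of j i l]) auto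
    next
      case 6
      then show ?thesis using N by (intro adjacent[of j i k]) auto
    qed
  qed
qed (use N in auto)

theorem theorem3p3:
  fixes N :: "'a set"
    and L G :: "'a ci_stmt set"
    and nrm :: "('a \<Rightarrow> 'a \<Rightarrow> real) \<Rightarrow> real"
    and \<epsilon> :: real
  assumes "finite N"
    and "L \<subseteq> ci_statements N"
    and "card L \<le> 2"
    and "minimal_gaussoid_extension N L G"
    and "norm_on_matrices N nrm"
    and "\<epsilon> > 0"
  shows "\<exists>S\<in>matrices N. symmetric_matrix N S \<and> positive_definite N S \<and>
    (\<forall>a\<in>N. \<forall>b\<in>N. S a b \<in> \<rat>) \<and>
    nrm (\<lambda>a b. S a b - identity_matrix N a b) < \<epsilon> \<and>
    ci_structure N S = G"
proof -
  have "ci_statements N \<subseteq> Pow N \<times> Pow N"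
    unfolding ci_statements_def by auto
  then have finite: "finite L"
    using assms(1,2) by (meson finite_Pow_iff finite_SigmaI finite_subset)
  have "realizable N {} G"
    using assms(1-4)
  proof (cases rule: minimal_gaussoid_extension_cases)
    case small
    consider "L = {}" | s where "L = {s}" | s t where "L = {s, t}" "s \<noteq> t"
    proof -
      have "card L = 0 \<or> card L = 1 \<or> card L = 2"
        using assms(3) by linarith
      then show thesis
      proof (elim disjE)
        assume "card L = 0"
        with finite show thesis
          by (intro that(1)) simp
      next
        assume "card L = 1"
        then show thesis
          by (rule card_1_singletonE) (rule that(2))
      next
        assume "card L = 2"
        then show thesis
          unfolding card_2_iff using that(3) by blast
      qed
    qed
    then show ?thesis
    proof cases
      case 1
      have "realizable N {} {}"
        using weights.realizes_empty by (intro realizable_if_weights[OF assms(1)]) blast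
      then show ?thesis
        using 1 small by simp
    next
      case 2
      then obtain i j K where "s = ci i j K" "i \<in> N" "j \<in> N" "i \<noteq> j" "K \<subseteq> N - {i, j}"
        using assms(2) unfolding ci_statements_def by blast
      then show ?thesis
        using realizable_singleton[OF assms(1)] 2 small by simp
    next
      case 3
      have "s \<in> ci_statements N" "t \<in> ci_statements N"
        using 3 assms(2) by auto
      then obtain i j K k l M where "s = ci i j K" "i \<in> N" "j \<in> N" "i \<noteq> j" "K \<subseteq> N - {i, j}"
        "t = ci k l M" "k \<in> N" "l \<in> N" "k \<noteq> l" "M \<subseteq> N - {k, l}"
        unfolding ci_statements_def by auto
      then show ?thesis
        using realizable_pair[OF assms(1)] 3 small by simp
    qed
  next
    case (square i j k M)
    then show ?thesis
      using realizable_square[OF assms(1)] by simp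
  qed
  moreover have "G \<subseteq> ci_statements N"
    using assms(4) unfolding minimal_gaussoid_extension_def gaussoid_def by blast
  ultimately show ?thesis
    using realizable_conclusion[OF assms(1,5,6)] by blast
qed

end
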